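(* A De Morgan monoid belongs to $\mathsf{M}$ if and only if it satisfies $e\leqslant f$ and is isomorphic to a subdirect product of skew reflections of Dunn monoids.
   Context: A residuated lattice (RL) is an algebra $\langle B;\cdot,\to,\wedge,\vee,e\rangle$ where $\langle B;\cdot,e\rangle$ is a commutative monoid, $\langle B;\wedge,\vee\rangle$ is a lattice and $x\cdot y\leqslant z$ iff $y\leqslant x\to z$. An involutive residuated lattice (IRL) is an algebra $\langle A;\cdot,\wedge,\vee,\neg,e\rangle$ where $\langle A;\cdot,e\rangle$ is a commutative monoid, $\langle A;\wedge,\vee\rangle$ is a lattice, and $\neg\neg x=x$ and ($x\cdot y\leqslant z$ iff $\neg z\cdot y\leqslant\neg x$); put $f:=\neg e$, $x\to y:=\neg(x\cdot\neg y)$, $x^2:=x\cdot x$. An RL or IRL is square-increasing if $x\leqslant x^2$, and distributive if its lattice reduct is. An IRL is anti-idempotent if it is square-increasing and satisfies $x\leqslant f^2$. A De Morgan monoid is a distributive square-increasing IRL; a Dunn monoid is a distributive square-increasing RL. $\mathsf{M}$ is the variety of anti-idempotent De Morgan monoids satisfying $e\leqslant f$ and $((f\to x)\vee(x\to e))\to\mathit{0}=\mathit{0}$, where $\mathit{0}:=\neg(f^2)$. Skew reflections. Let $B$ be a square-increasing RL with order $\leqslant^B$. Let $B'=\{b':b\in B\}$ be a disjoint copy of $B$, let $\mathit{0},\mathit{1}$ be distinct non-elements of $B\cup B'$, and $S=B\cup B'\cup\{\mathit{0},\mathit{1}\}$. Let $\leqslant$ be a lattice order on $S$ whose restriction to $B$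 is $\leqslant^B$ and such that for all $b,c\in B$: $b'\leqslant c'$ iff $c\leqslant b$; $b\leqslant c'$ iff $e\leqslant(b\cdot^B c)'$; $b'\not\leqslant c$; $\mathit{0}\leqslant b\leqslant\mathit{1}$ and $\mathit{0}\leqslant b'\leqslant\mathit{1}$. The skew $\leqslant$-reflection $\mathrm{S}^{\leqslant}(B)$ is the algebra $\langle S;\cdot,\wedge,\vee,\neg,e\rangle$, where $\wedge,\vee$ are the lattice operations of $\leqslant$, $\cdot$ is commutative and extends $\cdot^B$, $a\cdot\mathit{0}=\mathit{0}$ for all $a\in S$, $a\cdot\mathit{1}=\mathit{1}$ for all $a\in S\setminus\{\mathit{0}\}$, $b\cdot c'=(b\to^B c)'$ and $b'\cdot c'=\mathit{1}$ for $b,c\in B$, and $\neg\mathit{0}=\mathit{1}$, $\neg\mathit{1}=\mathit{0}$, $\neg b=b'$, $\neg(b')=b$ for $b\in B$. A skew reflection of $B$ is any algebra of this form. (It is always a square-increasing IRL, in which $f^2=\mathit{1}$ and $\neg(f^2)=\mathit{0}$.) The product of the empty family is a trivial algebra. *)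

theory Defs
  imports "HOL-Algebra.Group"
begin

section \<open>Residuated and involutive residuated lattices\<close>

text \<open>
  Following HOL-Algebra, algebras are records with an explicit carrier.  The monoid reduct is the
  library's monoid record, so the identity \<open>e\<close> is \<open>\<one>\<close>.  The names of the lattice operations
  avoid \<open>meet\<close> and \<open>join\<close>, which HOL-Algebra uses for operations derived from an order; the
  derived ones are used below for the lattice order of a skew reflection.
\<close>

record 'a lat_monoid = "'a monoid" +
  lmeet :: "'a \<Rightarrow> 'a \<Rightarrow> 'a" (infixl \<open>\<triangle>\<index>\<close> 70)
  ljoin :: "'a \<Rightarrow> 'a \<Rightarrow> 'a" (infixl \<open>\<nabla>\<index>\<close> 65)

record 'a rl = "'a lat_monoid" +
  imp :: "'a \<Rightarrow> 'a \<Rightarrow> 'a" (infixr \<open>\<leadsto>\<index>\<close> 60)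

record 'a irl = "'a lat_monoid" +
  lneg :: "'a \<Rightarrow> 'a" (\<open>neg\<index> _\<close> [81] 80)

definition leq :: "('a, 'm) lat_monoid_scheme \<Rightarrow> 'a \<Rightarrow> 'a \<Rightarrow> bool" (infix \<open>\<preceq>\<index>\<close> 50)
  where "x \<preceq>\<^bsub>A\<^esub> y \<longleftrightarrow> x \<triangle>\<^bsub>A\<^esub> y = x"

locale lattice_monoid = comm_monoid A for A :: "('a, 'm) lat_monoid_scheme" (structure) +
  assumes lmeet_closed: "\<lbrakk>x \<in> carrier A; y \<in> carrier A\<rbrakk> \<Longrightarrow> x \<triangle> y \<in> carrier A"
    and ljoin_closed: "\<lbrakk>x \<in> carrier A; y \<in> carrier A\<rbrakk> \<Longrightarrow> x \<nabla> y \<in> carrier A"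
    and lmeet_comm: "\<lbrakk>x \<in> carrier A; y \<in> carrier A\<rbrakk> \<Longrightarrow> x \<triangle> y = y \<triangle> x"
    and ljoin_comm: "\<lbrakk>x \<in> carrier A; y \<in> carrier A\<rbrakk> \<Longrightarrow> x \<nabla> y = y \<nabla> x"
    and lmeet_assoc: "\<lbrakk>x \<in> carrier A; y \<in> carrier A; z \<in> carrier A\<rbrakk>
      \<Longrightarrow> (x \<triangle> y) \<triangle> z = x \<triangle> (y \<triangle> z)"
    and ljoin_assoc: "\<lbrakk>x \<in> carrier A; y \<in> carrier A; z \<in> carrier A\<rbrakk>
      \<Longrightarrow> (x \<nabla> y) \<nabla> z = x \<nabla> (y \<nabla> z)"
    and lmeet_absorb: "\<lbrakk>x \<in> carrier A; y \<in> carrier A\<rbrakk> \<Longrightarrow> x \<triangle> (x \<nabla> y) = x"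
    and ljoin_absorb: "\<lbrakk>x \<in> carrier A; y \<in> carrier A\<rbrakk> \<Longrightarrow> x \<nabla> (x \<triangle> y) = x"

definition square_increasing :: "('a, 'm) lat_monoid_scheme \<Rightarrow> bool"
  where "square_increasing A \<longleftrightarrow> (\<forall>x\<in>carrier A. x \<preceq>\<^bsub>A\<^esub> x \<otimes>\<^bsub>A\<^esub> x)"

definition distributive :: "('a, 'm) lat_monoid_scheme \<Rightarrow> bool"
  where "distributive A \<longleftrightarrow> (\<forall>x\<in>carrier A. \<forall>y\<in>carrier A. \<forall>z\<in>carrier A.
    x \<triangle>\<^bsub>A\<^esub> (y \<nabla>\<^bsub>A\<^esub> z) = (x \<triangle>\<^bsub>A\<^esub> y) \<nabla>\<^bsub>A\<^esub> (x \<triangle>\<^bsub>A\<^esub> z))"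

locale residuated_lattice = lattice_monoid B for B :: "'a rl" (structure) +
  assumes imp_closed: "\<lbrakk>x \<in> carrier B; y \<in> carrier B\<rbrakk> \<Longrightarrow> x \<leadsto> y \<in> carrier B"
    and residuation: "\<lbrakk>x \<in> carrier B; y \<in> carrier B; z \<in> carrier B\<rbrakk>
      \<Longrightarrow> x \<otimes> y \<preceq> z \<longleftrightarrow> y \<preceq> x \<leadsto> z"

locale Dunn_monoid = residuated_lattice +
  assumes square_increasing: "square_increasing B"
    and distributive: "distributive B"

locale involutive_residuated_lattice = lattice_monoid A for A :: "'a irl" (structure) +
  assumes neg_closed: "x \<in> carrier A \<Longrightarrow> neg x \<in> carrier A"
    and neg_neg: "x \<in> carrier A \<Longrightarrow> neg (neg x) = x"
    and neg_residuation: "\<lbrakk>x \<in> carrier A; y \<in> carrier A; z \<in> carrier A\<rbrakk>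
      \<Longrightarrow> x \<otimes> y \<preceq> z \<longleftrightarrow> neg z \<otimes> y \<preceq> neg x"

locale De_Morgan_monoid = involutive_residuated_lattice +
  assumes square_increasing: "square_increasing A"
    and distributive: "distributive A"

definition irl_f :: "'a irl \<Rightarrow> 'a"
  where "irl_f A = neg\<^bsub>A\<^esub> \<one>\<^bsub>A\<^esub>"

definition irl_imp :: "'a irl \<Rightarrow> 'a \<Rightarrow> 'a \<Rightarrow> 'a"
  where "irl_imp A x y = neg\<^bsub>A\<^esub> (x \<otimes>\<^bsub>A\<^esub> neg\<^bsub>A\<^esub> y)"

definition irl_0 :: "'a irl \<Rightarrow> 'a"
  where "irl_0 A = neg\<^bsub>A\<^esub> (irl_f A \<otimes>\<^bsub>A\<^esub> irl_f A)"

definition anti_idempotent :: "'a irl \<Rightarrow> bool"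
  where "anti_idempotent A \<longleftrightarrow>
    square_increasing A \<and> (\<forall>x\<in>carrier A. x \<preceq>\<^bsub>A\<^esub> irl_f A \<otimes>\<^bsub>A\<^esub> irl_f A)"

definition in_M :: "'a irl \<Rightarrow> bool"
  where "in_M A \<longleftrightarrow> De_Morgan_monoid A \<and> anti_idempotent A \<and> \<one>\<^bsub>A\<^esub> \<preceq>\<^bsub>A\<^esub> irl_f A \<and>
    (\<forall>x\<in>carrier A.
      irl_imp A (irl_imp A (irl_f A) x \<nabla>\<^bsub>A\<^esub> irl_imp A x \<one>\<^bsub>A\<^esub>) (irl_0 A) = irl_0 A)"

section \<open>Skew reflections\<close>

text \<open>
  \<open>Base b\<close> is the element \<open>b\<close> of \<open>B\<close>, \<open>Refl b\<close> is its copy \<open>b'\<close>, and \<open>Zero\<close>, \<open>One\<close>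
  are the two new bounds.
\<close>

datatype 'b skew = Zero | One | Base 'b | Refl 'b

definition skew_carrier :: "'b rl \<Rightarrow> 'b skew set"
  where "skew_carrier B = Base ` carrier B \<union> Refl ` carrier B \<union> {Zero, One}"

abbreviation skew_gorder :: "'b rl \<Rightarrow> ('b skew \<Rightarrow> 'b skew \<Rightarrow> bool) \<Rightarrow> 'b skew gorder"
  where "skew_gorder B r \<equiv> \<lparr>carrier = skew_carrier B, eq = (=), le = r\<rparr>"

definition skew_order :: "'b rl \<Rightarrow> ('b skew \<Rightarrow> 'b skew \<Rightarrow> bool) \<Rightarrow> bool"
  where "skew_order B r \<longleftrightarrow> lattice (skew_gorder B r) \<and>
    (\<forall>b\<in>carrier B. \<forall>c\<in>carrier B.
      (r (Base b) (Base c) \<longleftrightarrow> b \<preceq>\<^bsub>B\<^esub> c) \<and>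
      (r (Refl b) (Refl c) \<longleftrightarrow> c \<preceq>\<^bsub>B\<^esub> b) \<and>
      (r (Base b) (Refl c) \<longleftrightarrow> r (Base \<one>\<^bsub>B\<^esub>) (Refl (b \<otimes>\<^bsub>B\<^esub> c))) \<and>
      \<not> r (Refl b) (Base c)) \<and>
    (\<forall>b\<in>carrier B. r Zero (Base b) \<and> r (Base b) One \<and> r Zero (Refl b) \<and> r (Refl b) One)"

fun skew_mult :: "'b rl \<Rightarrow> 'b skew \<Rightarrow> 'b skew \<Rightarrow> 'b skew"
  where
    "skew_mult B Zero y = Zero"
  | "skew_mult B x Zero = Zero"
  | "skew_mult B One y = One"
  | "skew_mult B x One = One"
  | "skew_mult B (Base b) (Base c) = Base (b \<otimes>\<^bsub>B\<^esub> c)"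
  | "skew_mult B (Base b) (Refl c) = Refl (b \<leadsto>\<^bsub>B\<^esub> c)"
  | "skew_mult B (Refl c) (Base b) = Refl (b \<leadsto>\<^bsub>B\<^esub> c)"
  | "skew_mult B (Refl b) (Refl c) = One"

fun skew_neg :: "'b skew \<Rightarrow> 'b skew"
  where
    "skew_neg Zero = One"
  | "skew_neg One = Zero"
  | "skew_neg (Base b) = Refl b"
  | "skew_neg (Refl b) = Base b"

definition skew_algebra :: "'b rl \<Rightarrow> ('b skew \<Rightarrow> 'b skew \<Rightarrow> bool) \<Rightarrow> 'b skew irl"
  where "skew_algebra B r =
    \<lparr>carrier = skew_carrier B,
     monoid.mult = skew_mult B,
     one = Base \<one>\<^bsub>B\<^esub>,
     lmeet = Lattice.meet (skew_gorder B r),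
     ljoin = Lattice.join (skew_gorder B r),
     lneg = skew_neg\<rparr>"

definition skew_reflection :: "'b rl \<Rightarrow> 'b skew irl \<Rightarrow> bool"
  where "skew_reflection B S \<longleftrightarrow> residuated_lattice B \<and> square_increasing B \<and>
    (\<exists>r. skew_order B r \<and> S = skew_algebra B r)"

section \<open>Subdirect products\<close>

definition irl_iso :: "'a irl \<Rightarrow> 'c irl \<Rightarrow> ('a \<Rightarrow> 'c) set"
  where "irl_iso A C = {h \<in> hom A C.
    bij_betw h (carrier A) (carrier C) \<and>
    h \<one>\<^bsub>A\<^esub> = \<one>\<^bsub>C\<^esub> \<and>
    (\<forall>x\<in>carrier A. h (neg\<^bsub>A\<^esub> x) = neg\<^bsub>C\<^esub> (h x)) \<and>
    (\<forall>x\<in>carrier A. \<forall>y\<in>carrier A.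
      h (x \<triangle>\<^bsub>A\<^esub> y) = h x \<triangle>\<^bsub>C\<^esub> h y \<and> h (x \<nabla>\<^bsub>A\<^esub> y) = h x \<nabla>\<^bsub>C\<^esub> h y)}"

text \<open>For \<open>I = {}\<close> the carrier is a singleton, i.e. the product is trivial.\<close>

definition direct_product :: "'i set \<Rightarrow> ('i \<Rightarrow> 'c irl) \<Rightarrow> ('i \<Rightarrow> 'c) irl"
  where "direct_product I F =
    \<lparr>carrier = (\<Pi>\<^sub>E i\<in>I. carrier (F i)),
     monoid.mult = (\<lambda>x y. \<lambda>i\<in>I. x i \<otimes>\<^bsub>F i\<^esub> y i),
     one = (\<lambda>i\<in>I. \<one>\<^bsub>F i\<^esub>),
     lmeet = (\<lambda>x y. \<lambda>i\<in>I. x i \<triangle>\<^bsub>F i\<^esub> y i),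
     ljoin = (\<lambda>x y. \<lambda>i\<in>I. x i \<nabla>\<^bsub>F i\<^esub> y i),
     lneg = (\<lambda>x. \<lambda>i\<in>I. neg\<^bsub>F i\<^esub> (x i))\<rparr>"

definition subuniverse :: "'a set \<Rightarrow> 'a irl \<Rightarrow> bool"
  where "subuniverse U A \<longleftrightarrow> U \<subseteq> carrier A \<and> \<one>\<^bsub>A\<^esub> \<in> U \<and> (\<forall>x\<in>U. neg\<^bsub>A\<^esub> x \<in> U) \<and>
    (\<forall>x\<in>U. \<forall>y\<in>U. x \<otimes>\<^bsub>A\<^esub> y \<in> U \<and> x \<triangle>\<^bsub>A\<^esub> y \<in> U \<and> x \<nabla>\<^bsub>A\<^esub> y \<in> U)"

definition subdirect_product :: "'i set \<Rightarrow> ('i \<Rightarrow> 'c irl) \<Rightarrow> ('i \<Rightarrow> 'c) irl \<Rightarrow> bool"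
  where "subdirect_product I F C \<longleftrightarrow>
    (\<exists>U. subuniverse U (direct_product I F) \<and> C = (direct_product I F)\<lparr>carrier := U\<rparr> \<and>
      (\<forall>i\<in>I. (\<lambda>x. x i) ` U = carrier (F i)))"

text \<open>
  HOL cannot quantify over types inside a formula, so the type \<open>'i\<close> of indices and the type \<open>'b\<close>
  in which the Dunn monoids live are parameters.
\<close>

definition subdirect_of_skew_reflections :: "'i itself \<Rightarrow> 'b itself \<Rightarrow> 'a irl \<Rightarrow> bool"
  where "subdirect_of_skew_reflections (_ :: 'i itself) (_ :: 'b itself) A \<longleftrightarrow>
    (\<exists>(I :: 'i set) (F :: 'i \<Rightarrow> 'b skew irl) C.
      (\<forall>i\<in>I. \<exists>B. Dunn_monoid B \<and> skew_reflection B (F i)) \<and>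
      subdirect_product I F C \<and> irl_iso A C \<noteq> {})"

end

theory Submission
  imports Defs
begin

text \<open>
  In a De Morgan monoid, the deductive filters are the lattice filters containing \<open>e\<close>, so the
  quotients by prime ones separate points and have a join-prime identity.  If such a quotient of a
  member of M is nontrivial with bounds \<open>0\<close> and \<open>1\<close>, then \<open>a \<cdot> 1 = 1\<close> whenever \<open>a \<noteq> 0\<close>, so
  products of nonzero elements are nonzero.  Its nonzero elements \<open>x\<close> with \<open>u \<cdot> x \<preceq> e\<close> for some
  \<open>u \<noteq> 0\<close> form a Dunn monoid \<open>B\<close> disjoint from \<open>{\<not>b | b \<in> B}\<close>, and the equation
  defining M forces every element other than \<open>0, 1\<close> into one of these two sets; this exhibits the
  quotient as a skew reflection of \<open>B\<close>.  Conversely, the axioms of M are inequalities and equations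
  that are checked in each skew reflection and transfer along the embedding.
\<close>

section \<open>Order and residuation\<close>

context lattice_monoid
begin

declare lmeet_closed [simp, intro] ljoin_closed [simp, intro]

lemma lmeet_idem: "x \<in> carrier A \<Longrightarrow> x \<triangle> x = x"
  using lmeet_absorb[of x "x \<triangle> x"] ljoin_absorb[of x x] by simp

lemma leq_refl [simp, intro]: "x \<in> carrier A \<Longrightarrow> x \<preceq> x"
  by (simp add: leq_def lmeet_idem)

lemma leq_antisym: "\<lbrakk>x \<preceq> y; y \<preceq> x; x \<in> carrier A; y \<in> carrier A\<rbrakk> \<Longrightarrow> x = y"
  unfolding leq_def by (metis lmeet_comm)

lemma leq_trans [trans]:
  "\<lbrakk>x \<preceq> y; y \<preceq> z; x \<in> carrier A; y \<in> carrier A; z \<in> carrier A\<rbrakk> \<Longrightarrow> x \<preceq> z"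
  unfolding leq_def by (metis lmeet_assoc)

lemma leq_iff_ljoin: "\<lbrakk>x \<in> carrier A; y \<in> carrier A\<rbrakk> \<Longrightarrow> x \<preceq> y \<longleftrightarrow> x \<nabla> y = y"
  unfolding leq_def by (metis ljoin_absorb ljoin_comm lmeet_absorb lmeet_comm)

lemma lmeet_leq1: "\<lbrakk>x \<in> carrier A; y \<in> carrier A\<rbrakk> \<Longrightarrow> x \<triangle> y \<preceq> x"
  unfolding leq_def by (metis lmeet_assoc lmeet_comm lmeet_idem)

lemma lmeet_leq2: "\<lbrakk>x \<in> carrier A; y \<in> carrier A\<rbrakk> \<Longrightarrow> x \<triangle> y \<preceq> y"
  by (metis lmeet_comm lmeet_leq1)

lemma leq_lmeet:
  "\<lbrakk>z \<preceq> x; z \<preceq> y; x \<in> carrier A; y \<in> carrier A; z \<in> carrier A\<rbrakk> \<Longrightarrow> z \<preceq> x \<triangle> y"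
  unfolding leq_def by (metis lmeet_assoc)

lemma lmeet_mono1:
  assumes "x \<preceq> y" and [simp]: "x \<in> carrier A" "y \<in> carrier A" "z \<in> carrier A"
  shows "x \<triangle> z \<preceq> y \<triangle> z"
  using leq_trans[OF lmeet_leq1 assms(1)] by (intro leq_lmeet) (auto simp: lmeet_leq2)

lemma leq_ljoin1: "\<lbrakk>x \<in> carrier A; y \<in> carrier A\<rbrakk> \<Longrightarrow> x \<preceq> x \<nabla> y"
  by (simp add: leq_def lmeet_absorb)

lemma leq_ljoin2: "\<lbrakk>x \<in> carrier A; y \<in> carrier A\<rbrakk> \<Longrightarrow> y \<preceq> x \<nabla> y"
  by (metis leq_ljoin1 ljoin_comm)

lemma ljoin_leq:
  "\<lbrakk>x \<preceq> z; y \<preceq> z; x \<in> carrier A; y \<in> carrier A; z \<in> carrier A\<rbrakk> \<Longrightarrow> x \<nabla> y \<preceq> z"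
  by (simp add: leq_iff_ljoin ljoin_assoc)

end

section \<open>Residuation and contraposition under the involution\<close>

context involutive_residuated_lattice
begin

declare neg_closed [simp, intro] neg_neg [simp]

abbreviation arr (infixr \<open>\<rightharpoonup>\<close> 60) where "x \<rightharpoonup> y \<equiv> irl_imp A x y"
abbreviation ff where "ff \<equiv> irl_f A"

lemma irl_f_closed [simp, intro]: "ff \<in> carrier A"
  by (simp add: irl_f_def)

lemma irl_imp_closed [simp, intro]: "\<lbrakk>x \<in> carrier A; y \<in> carrier A\<rbrakk> \<Longrightarrow> x \<rightharpoonup> y \<in> carrier A"
  by (simp add: irl_imp_def)

lemma irl_0_closed [simp, intro]: "irl_0 A \<in> carrier A"
  by (simp add: irl_0_def)

lemma neg_leq_neg_iff: "\<lbrakk>x \<in> carrier A; y \<in> carrier A\<rbrakk> \<Longrightarrow> neg y \<preceq> neg x \<longleftrightarrow> x \<preceq> y"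
  using neg_residuation[of x "\<one>" y] by simp

text \<open>Involutive residuation with \<open>x\<close> and \<open>y\<close> exchanged, followed by
  contraposition, isolates \<open>y\<close>; the bound obtained unfolds to the implication.\<close>

lemma irl_residuation:
  assumes "x \<in> carrier A" "y \<in> carrier A" "z \<in> carrier A"
  shows "x \<otimes> y \<preceq> z \<longleftrightarrow> y \<preceq> x \<rightharpoonup> z"
proof -
  have "x \<otimes> y \<preceq> z \<longleftrightarrow> neg z \<otimes> x \<preceq> neg y"
    using neg_residuation[of y x z] assms by (simp add: m_comm)
  also have "\<dots> \<longleftrightarrow> y \<preceq> neg (neg z \<otimes> x)"
    using neg_leq_neg_iff[of y "neg (neg z \<otimes> x)"] assms by simp
  finally show ?thesis
    using assms by (simp add: irl_imp_def m_comm)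
qed

lemma irl_imp_mp: "\<lbrakk>x \<in> carrier A; y \<in> carrier A\<rbrakk> \<Longrightarrow> x \<otimes> (x \<rightharpoonup> y) \<preceq> y"
  by (simp add: irl_residuation)

lemma leq_iff_one_leq_imp: "\<lbrakk>x \<in> carrier A; y \<in> carrier A\<rbrakk> \<Longrightarrow> x \<preceq> y \<longleftrightarrow> \<one> \<preceq> x \<rightharpoonup> y"
  using irl_residuation[of x \<one> y] by simp

lemma one_imp: "x \<in> carrier A \<Longrightarrow> \<one> \<rightharpoonup> x = x"
  by (simp add: irl_imp_def)

lemma mult_mono1:
  assumes "x \<preceq> y" "x \<in> carrier A" "y \<in> carrier A" "z \<in> carrier A"
  shows "z \<otimes> x \<preceq> z \<otimes> y"
proof -
  have "y \<preceq> z \<rightharpoonup> (z \<otimes> y)"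
    using assms by (simp flip: irl_residuation)
  then show ?thesis
    using assms by (meson irl_imp_closed irl_residuation leq_trans m_closed)
qed

lemma mult_mono:
  assumes "x \<preceq> y" "u \<preceq> v" "x \<in> carrier A" "y \<in> carrier A" "u \<in> carrier A" "v \<in> carrier A"
  shows "x \<otimes> u \<preceq> y \<otimes> v"
  using assms leq_trans[of "x \<otimes> u" "x \<otimes> v" "y \<otimes> v"] mult_mono1[of u v x] mult_mono1[of x y v]
  by (simp add: m_comm)

lemma mult_neg_leq_f: "x \<in> carrier A \<Longrightarrow> x \<otimes> neg x \<preceq> ff"
  using neg_residuation[of x "neg x" ff] by (simp add: irl_f_def)

lemma mult_leq_neg_iff:
  assumes "x \<in> carrier A" "y \<in> carrier A"
  shows "x \<preceq> neg y \<longleftrightarrow> x \<otimes> y \<preceq> ff"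
  using assms irl_residuation[of y x ff] by (simp add: irl_imp_def irl_f_def m_comm)

end

section \<open>Quotients by filters above the identity\<close>

context De_Morgan_monoid
begin

lemma leq_square: "x \<in> carrier A \<Longrightarrow> x \<preceq> x \<otimes> x"
  using square_increasing by (simp add: square_increasing_def)

lemma lmeet_ljoin_distrib:
  "\<lbrakk>x \<in> carrier A; y \<in> carrier A; z \<in> carrier A\<rbrakk> \<Longrightarrow> x \<triangle> (y \<nabla> z) = (x \<triangle> y) \<nabla> (x \<triangle> z)"
  using distributive by (simp add: distributive_def)

text \<open>Square \<open>x \<triangle> y\<close> and use monotonicity. Filters closed under meets
  are therefore closed under multiplication.\<close>

lemma lmeet_leq_mult:
  assumes [simp]: "x \<in> carrier A" "y \<in> carrier A"
  shows "x \<triangle> y \<preceq> x \<otimes> y"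
  by (rule leq_trans[OF leq_square mult_mono]) (auto simp: lmeet_leq1 lmeet_leq2)

text \<open>The negated join lies below both \<open>x\<close> and \<open>neg x\<close>, hence below
  their product and below \<open>f\<close>; contrapose. With a join-prime identity this gives a case
  split between \<open>x\<close> and \<open>neg x\<close>.\<close>

lemma one_leq_ljoin_neg:
  assumes [simp]: "x \<in> carrier A"
  shows "\<one> \<preceq> x \<nabla> neg x"
proof -
  let ?z = "neg (x \<nabla> neg x)"
  have "?z \<preceq> neg x" "?z \<preceq> x"
    using neg_leq_neg_iff[of x "x \<nabla> neg x"] neg_leq_neg_iff[of "neg x" "x \<nabla> neg x"]
    by (simp_all add: leq_ljoin1 leq_ljoin2)
  then have "?z \<preceq> x \<otimes> neg x"
    by (intro leq_trans[OF _ lmeet_leq_mult] leq_lmeet) auto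
  then have "?z \<preceq> ff"
    by (rule leq_trans[OF _ mult_neg_leq_f]) auto
  then show ?thesis
    using neg_leq_neg_iff[of \<one> "x \<nabla> neg x"] by (simp add: irl_f_def)
qed

end

section \<open>Prime filters above the identity\<close>

definition e_filter :: "'a irl \<Rightarrow> 'a set \<Rightarrow> bool"
  where "e_filter A G \<longleftrightarrow> G \<subseteq> carrier A \<and> \<one>\<^bsub>A\<^esub> \<in> G \<and>
    (\<forall>x\<in>G. \<forall>y\<in>G. x \<triangle>\<^bsub>A\<^esub> y \<in> G) \<and> (\<forall>x\<in>G. \<forall>y\<in>carrier A. x \<preceq>\<^bsub>A\<^esub> y \<longrightarrow> y \<in> G)"

definition prime_e_filter :: "'a irl \<Rightarrow> 'a set \<Rightarrow> bool"
  where "prime_e_filter A G \<longleftrightarrow> e_filter A G \<and> G \<noteq> carrier A \<and>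
    (\<forall>x\<in>carrier A. \<forall>y\<in>carrier A. x \<nabla>\<^bsub>A\<^esub> y \<in> G \<longrightarrow> x \<in> G \<or> y \<in> G)"

text \<open>The filter generated by \<open>G\<close> and \<open>x\<close>, used to exploit
  maximality in the prime filter theorem.\<close>

lemma (in De_Morgan_monoid) e_filter_extend:
  assumes G: "e_filter A G" and x [simp]: "x \<in> carrier A"
  shows "e_filter A {z \<in> carrier A. \<exists>p\<in>G. p \<triangle> x \<preceq> z}" (is "e_filter A ?H")
    and "G \<subseteq> {z \<in> carrier A. \<exists>p\<in>G. p \<triangle> x \<preceq> z}"
    and "x \<in> {z \<in> carrier A. \<exists>p\<in>G. p \<triangle> x \<preceq> z}"
proof -
  have GA [simp]: "p \<in> carrier A" if "p \<in> G" for p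
    using G that unfolding e_filter_def by blast
  show "G \<subseteq> ?H"
    using lmeet_leq1[OF GA x] by auto
  show "x \<in> ?H"
    using G lmeet_leq2[of \<one> x] by (auto simp: e_filter_def)
  show "e_filter A ?H"
    unfolding e_filter_def
  proof (intro conjI ballI impI)
    show "\<one> \<in> ?H"
      using G \<open>G \<subseteq> ?H\<close> by (auto simp: e_filter_def)
  next
    fix y z assume "y \<in> ?H" "z \<in> ?H"
    then obtain p q where pq: "p \<in> G" "p \<triangle> x \<preceq> y" "q \<in> G" "q \<triangle> x \<preceq> z"
      and [simp]: "y \<in> carrier A" "z \<in> carrier A"
      by auto
    note [simp] = pq(1,3)
    have "(p \<triangle> q) \<triangle> x \<preceq> y" "(p \<triangle> q) \<triangle> x \<preceq> z"
      using leq_trans[OF lmeet_mono1[OF lmeet_leq1] pq(2)]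
        leq_trans[OF lmeet_mono1[OF lmeet_leq2] pq(4)] by simp_all
    then have "(p \<triangle> q) \<triangle> x \<preceq> y \<triangle> z"
      by (simp add: leq_lmeet)
    moreover have "p \<triangle> q \<in> G"
      using G by (simp add: e_filter_def)
    ultimately show "y \<triangle> z \<in> ?H"
      by auto
  next
    fix y z assume "y \<in> ?H" and z: "z \<in> carrier A" "y \<preceq> z"
    then obtain p where "p \<in> G" "p \<triangle> x \<preceq> y" "y \<in> carrier A"
      by auto
    then show "z \<in> ?H"
      using z leq_trans[of "p \<triangle> x" y z] by auto
  qed auto
qed

text \<open>Prime filter theorem: Zorn's lemma gives a filter maximal among those omitting
  \<open>d\<close>, and distributivity makes it prime.\<close>

lemma (in De_Morgan_monoid) prime_e_filter_separation:
  assumes d [simp]: "d \<in> carrier A" and nd: "\<not> \<one> \<preceq> d"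
  obtains G where "prime_e_filter A G" "d \<notin> G"
proof -
  let ?\<A> = "{G. e_filter A G \<and> d \<notin> G}"
  \<comment> \<open>The principal filter of \<open>e\<close> omits \<open>d\<close>, so the family
    is nonempty.\<close>
  have "\<one> \<preceq> y" if "x \<in> carrier A" "\<one> \<preceq> x" "y \<in> carrier A" "x \<preceq> y" for x y
    using leq_trans[of \<one> x y] that by simp
  then have "e_filter A {z \<in> carrier A. \<one> \<preceq> z}"
    by (auto simp: e_filter_def leq_lmeet)
  then have "?\<A> \<noteq> {}"
    using nd by blast
  moreover have "\<Union>\<C> \<in> ?\<A>" if "\<C> \<noteq> {}" and ch: "subset.chain ?\<A> \<C>" for \<C>
  proof -
    have C: "e_filter A G" "d \<notin> G" if "G \<in> \<C>" for G
      using ch that by (auto simp: subset.chain_def)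
    have tot: "G \<subseteq> H \<or> H \<subseteq> G" if "G \<in> \<C>" "H \<in> \<C>" for G H
      using ch that by (auto simp: subset.chain_def)
    have "e_filter A (\<Union>\<C>)"
      unfolding e_filter_def
    proof (intro conjI ballI impI)
      fix x y assume "x \<in> \<Union>\<C>" "y \<in> \<Union>\<C>"
      then obtain G H where "G \<in> \<C>" "H \<in> \<C>" "x \<in> G" "y \<in> H"
        by blast
      then obtain G where "G \<in> \<C>" "x \<in> G" "y \<in> G"
        using tot[of G H] by blast
      then show "x \<triangle> y \<in> \<Union>\<C>"
        using C(1)[unfolded e_filter_def] by blast
    qed (use C(1)[unfolded e_filter_def] \<open>\<C> \<noteq> {}\<close> in blast)+
    then show ?thesis
      using C(2) by blast
  qed
  ultimately have "\<exists>M\<in>?\<A>. \<forall>X\<in>?\<A>. M \<subseteq> X \<longrightarrow> X = M"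
    by (rule subset_Zorn_nonempty)
  then obtain M where M: "e_filter A M" "d \<notin> M"
    and max: "\<And>H. \<lbrakk>e_filter A H; d \<notin> H; M \<subseteq> H\<rbrakk> \<Longrightarrow> H = M"
    by blast
  have MA [simp]: "p \<in> carrier A" if "p \<in> M" for p
    using M that unfolding e_filter_def by blast
  \<comment> \<open>By maximality, adjoining an element outside \<open>M\<close> forces
    \<open>d\<close> into the generated filter.\<close>
  have ext: "\<exists>p\<in>M. p \<triangle> x \<preceq> d" if "x \<in> carrier A" "x \<notin> M" for x
  proof (rule ccontr)
    let ?H = "{z \<in> carrier A. \<exists>p\<in>M. p \<triangle> x \<preceq> z}"
    assume "\<not> ?thesis"
    then have "?H = M"
      by (intro max e_filter_extend M that) auto
    then show False
      using e_filter_extend(3)[OF M(1) that(1)] that(2) by blast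
  qed
  have "x \<in> M \<or> y \<in> M"
    if xA [simp]: "x \<in> carrier A" and yA [simp]: "y \<in> carrier A" and xy: "x \<nabla> y \<in> M" for x y
  proof (rule ccontr)
    assume "\<not> ?thesis"
    then obtain p q where pq: "p \<in> M" "p \<triangle> x \<preceq> d" "q \<in> M" "q \<triangle> y \<preceq> d"
      using ext[OF xA] ext[OF yA] by blast
    note [simp] = pq(1,3)
    have "(p \<triangle> q) \<triangle> x \<preceq> d" "(p \<triangle> q) \<triangle> y \<preceq> d"
      using leq_trans[OF lmeet_mono1[OF lmeet_leq1] pq(2)]
        leq_trans[OF lmeet_mono1[OF lmeet_leq2] pq(4)] by simp_all
    \<comment> \<open>Distributivity splits the left side into two meets, each below
      \<open>d\<close>.\<close>
    then have "(p \<triangle> q) \<triangle> (x \<nabla> y) \<preceq> d"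
      by (simp add: lmeet_ljoin_distrib ljoin_leq)
    moreover have "(p \<triangle> q) \<triangle> (x \<nabla> y) \<in> M"
      using M(1)[unfolded e_filter_def] pq(1,3) xy by blast
    ultimately show False
      using M d unfolding e_filter_def by blast
  qed
  moreover have "M \<noteq> carrier A"
    using M(2) d by blast
  ultimately have "prime_e_filter A M"
    using M(1) by (simp add: prime_e_filter_def)
  then show ?thesis
    using M(2) by (rule that)
qed

section \<open>The congruence of a filter and its quotient\<close>

definition filter_cong :: "'a irl \<Rightarrow> 'a set \<Rightarrow> ('a \<times> 'a) set"
  where "filter_cong A G =
    {(x, y). x \<in> carrier A \<and> y \<in> carrier A \<and> irl_imp A x y \<in> G \<and> irl_imp A y x \<in> G}"

text \<open>Operations act on representatives picked by \<open>SOME\<close>; for the binary ones,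
  \<open>cls_compatible\<close> shows that the choice does not matter.\<close>

definition quotient_irl :: "'a irl \<Rightarrow> ('a \<times> 'a) set \<Rightarrow> 'a set irl"
  where "quotient_irl A \<theta> =
    \<lparr>carrier = carrier A // \<theta>,
     monoid.mult = (\<lambda>X Y. \<theta> `` {(SOME x. x \<in> X) \<otimes>\<^bsub>A\<^esub> (SOME y. y \<in> Y)}),
     one = \<theta> `` {\<one>\<^bsub>A\<^esub>},
     lmeet = (\<lambda>X Y. \<theta> `` {(SOME x. x \<in> X) \<triangle>\<^bsub>A\<^esub> (SOME y. y \<in> Y)}),
     ljoin = (\<lambda>X Y. \<theta> `` {(SOME x. x \<in> X) \<nabla>\<^bsub>A\<^esub> (SOME y. y \<in> Y)}),
     lneg = (\<lambda>X. \<theta> `` {neg\<^bsub>A\<^esub> (SOME x. x \<in> X)})\<rparr>"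

locale De_Morgan_filter = De_Morgan_monoid +
  fixes G
  assumes filter: "e_filter A G"
begin

abbreviation below (infix \<open>\<sqsubseteq>\<^sub>G\<close> 50) where "x \<sqsubseteq>\<^sub>G y \<equiv> x \<rightharpoonup> y \<in> G"
abbreviation cls where "cls x \<equiv> filter_cong A G `` {x}"
abbreviation Q where "Q \<equiv> quotient_irl A (filter_cong A G)"

lemma filter_carrier [simp]: "x \<in> G \<Longrightarrow> x \<in> carrier A"
  using filter unfolding e_filter_def by blast

lemma filter_one: "\<one> \<in> G"
  and filter_lmeet: "\<lbrakk>x \<in> G; y \<in> G\<rbrakk> \<Longrightarrow> x \<triangle> y \<in> G"
  and filter_up: "\<lbrakk>x \<in> G; x \<preceq> y; y \<in> carrier A\<rbrakk> \<Longrightarrow> y \<in> G"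
  using filter unfolding e_filter_def by blast+

lemma filter_mult: "\<lbrakk>x \<in> G; y \<in> G\<rbrakk> \<Longrightarrow> x \<otimes> y \<in> G"
  by (rule filter_up[OF filter_lmeet lmeet_leq_mult]) auto

lemma belowI: "\<lbrakk>p \<in> G; p \<otimes> x \<preceq> y; x \<in> carrier A; y \<in> carrier A\<rbrakk> \<Longrightarrow> x \<sqsubseteq>\<^sub>G y"
  by (rule filter_up[of p]) (auto simp: m_comm simp flip: irl_residuation)

text \<open>Cutting the implication down by \<open>e\<close> gives a multiplier that satisfies
  \<open>p \<otimes> z \<preceq> z\<close>; compatibility with meet and join depends on
  this.\<close>

lemma belowE:
  assumes "x \<sqsubseteq>\<^sub>G y" and [simp]: "x \<in> carrier A" "y \<in> carrier A"
  obtains p where "p \<in> G" "p \<preceq> \<one>" "p \<otimes> x \<preceq> y"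
proof
  let ?p = "(x \<rightharpoonup> y) \<triangle> \<one>"
  show "?p \<in> G"
    using assms by (simp add: filter_lmeet filter_one)
  show "?p \<preceq> \<one>"
    by (simp add: lmeet_leq2)
  show "?p \<otimes> x \<preceq> y"
    by (simp add: m_comm[of _ x] irl_residuation lmeet_leq1)
qed

lemma leq_imp_below: "\<lbrakk>x \<preceq> y; x \<in> carrier A; y \<in> carrier A\<rbrakk> \<Longrightarrow> x \<sqsubseteq>\<^sub>G y"
  using filter_one by (intro belowI[of \<one>]) auto

lemma below_trans:
  assumes xy: "x \<sqsubseteq>\<^sub>G y" and yz: "y \<sqsubseteq>\<^sub>G z"
    and [simp]: "x \<in> carrier A" "y \<in> carrier A" "z \<in> carrier A"
  shows "x \<sqsubseteq>\<^sub>G z"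
proof -
  obtain p where p: "p \<in> G" "p \<otimes> x \<preceq> y" by (rule belowE[OF xy]) auto
  obtain q where q: "q \<in> G" "q \<otimes> y \<preceq> z" by (rule belowE[OF yz]) auto
  have "q \<otimes> (p \<otimes> x) \<preceq> z"
    using leq_trans[OF mult_mono1[OF p(2), of q] q(2)] p(1) q(1) by simp
  then show ?thesis
    using p(1) q(1) by (intro belowI[of "q \<otimes> p"]) (auto simp: filter_mult m_assoc)
qed

lemma below_mult:
  assumes xy: "x \<sqsubseteq>\<^sub>G y" and [simp]: "x \<in> carrier A" "y \<in> carrier A" "z \<in> carrier A"
  shows "x \<otimes> z \<sqsubseteq>\<^sub>G y \<otimes> z"
proof -
  obtain p where p: "p \<in> G" "p \<otimes> x \<preceq> y" by (rule belowE[OF xy]) auto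
  then have "(p \<otimes> x) \<otimes> z \<preceq> y \<otimes> z"
    by (intro mult_mono) auto
  then show ?thesis
    using p by (intro belowI[of p]) (auto simp: m_assoc)
qed

lemma mult_leq_right: "\<lbrakk>p \<preceq> \<one>; p \<in> carrier A; x \<in> carrier A\<rbrakk> \<Longrightarrow> p \<otimes> x \<preceq> x"
  using mult_mono[of p \<one> x x] by simp

lemma below_lmeet:
  assumes xy: "x \<sqsubseteq>\<^sub>G y" and [simp]: "x \<in> carrier A" "y \<in> carrier A" "z \<in> carrier A"
  shows "x \<triangle> z \<sqsubseteq>\<^sub>G y \<triangle> z"
proof -
  obtain p where p: "p \<in> G" "p \<preceq> \<one>" "p \<otimes> x \<preceq> y" by (rule belowE[OF xy]) auto
  note [simp] = p(1)
  have "p \<otimes> (x \<triangle> z) \<preceq> p \<otimes> x" "p \<otimes> (x \<triangle> z) \<preceq> p \<otimes> z"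
    by (auto intro!: mult_mono1 simp: lmeet_leq1 lmeet_leq2)
  then have "p \<otimes> (x \<triangle> z) \<preceq> y" "p \<otimes> (x \<triangle> z) \<preceq> z"
    using leq_trans[of "p \<otimes> (x \<triangle> z)" "p \<otimes> x" y] p(3)
      leq_trans[of "p \<otimes> (x \<triangle> z)" "p \<otimes> z" z] mult_leq_right[OF p(2), of z] by simp_all
  then show ?thesis
    by (intro belowI[of p] leq_lmeet) auto
qed

lemma below_ljoin:
  assumes xy: "x \<sqsubseteq>\<^sub>G y" and [simp]: "x \<in> carrier A" "y \<in> carrier A" "z \<in> carrier A"
  shows "x \<nabla> z \<sqsubseteq>\<^sub>G y \<nabla> z"
proof -
  obtain p where p: "p \<in> G" "p \<preceq> \<one>" "p \<otimes> x \<preceq> y" by (rule belowE[OF xy]) auto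
  note [simp] = p(1)
  have "p \<otimes> x \<preceq> y \<nabla> z" "p \<otimes> z \<preceq> y \<nabla> z"
    using leq_trans[OF p(3) leq_ljoin1] leq_trans[OF mult_leq_right[OF p(2)] leq_ljoin2] by auto
  \<comment> \<open>Residuation handles multiplication of a join by \<open>p\<close>: bounding each
    joinand suffices.\<close>
  then have "x \<nabla> z \<preceq> p \<rightharpoonup> (y \<nabla> z)"
    by (intro ljoin_leq) (auto simp: irl_residuation)
  then show ?thesis
    by (intro belowI[of p]) (auto simp: irl_residuation)
qed

text \<open>The two implications are the same element, by double negation and commutativity.\<close>

lemma below_neg: "\<lbrakk>x \<sqsubseteq>\<^sub>G y; x \<in> carrier A; y \<in> carrier A\<rbrakk> \<Longrightarrow> neg y \<sqsubseteq>\<^sub>G neg x"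
  by (simp add: irl_imp_def m_comm)

lemma filter_cong_iff:
  "\<lbrakk>x \<in> carrier A; y \<in> carrier A\<rbrakk> \<Longrightarrow> (x, y) \<in> filter_cong A G \<longleftrightarrow> x \<sqsubseteq>\<^sub>G y \<and> y \<sqsubseteq>\<^sub>G x"
  by (simp add: filter_cong_def)

lemma equiv_filter_cong: "equiv (carrier A) (filter_cong A G)"
proof (rule equivI)
  show "refl_on (carrier A) (filter_cong A G)"
    by (auto simp: refl_on_def filter_cong_iff intro: leq_imp_below)
  show "sym (filter_cong A G)"
    by (auto simp: sym_def filter_cong_def)
  show "trans (filter_cong A G)"
    unfolding trans_def filter_cong_def using below_trans by blast
qed (auto simp: filter_cong_def)

lemma cls_eq_iff:
  "\<lbrakk>x \<in> carrier A; y \<in> carrier A\<rbrakk> \<Longrightarrow> cls x = cls y \<longleftrightarrow> x \<sqsubseteq>\<^sub>G y \<and> y \<sqsubseteq>\<^sub>G x"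
  using equiv_filter_cong by (simp add: eq_equiv_class_iff filter_cong_iff)

lemma rep_cls:
  assumes "x \<in> carrier A"
  shows "(SOME y. y \<in> cls x) \<in> carrier A" "(SOME y. y \<in> cls x) \<sqsubseteq>\<^sub>G x"
    "x \<sqsubseteq>\<^sub>G (SOME y. y \<in> cls x)"
proof -
  have "(SOME y. y \<in> cls x) \<in> cls x"
    using equiv_class_self[OF equiv_filter_cong assms] by (rule someI)
  then show "(SOME y. y \<in> cls x) \<in> carrier A" "(SOME y. y \<in> cls x) \<sqsubseteq>\<^sub>G x"
    "x \<sqsubseteq>\<^sub>G (SOME y. y \<in> cls x)"
    unfolding filter_cong_def by blast+
qed

lemma cls_compatible:
  assumes mono: "\<And>x y z. \<lbrakk>x \<sqsubseteq>\<^sub>G y; x \<in> carrier A; y \<in> carrier A; z \<in> carrier A\<rbrakk>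
      \<Longrightarrow> op x z \<sqsubseteq>\<^sub>G op y z"
    and comm: "\<And>x y. \<lbrakk>x \<in> carrier A; y \<in> carrier A\<rbrakk> \<Longrightarrow> op x y = op y x"
    and closed: "\<And>x y. \<lbrakk>x \<in> carrier A; y \<in> carrier A\<rbrakk> \<Longrightarrow> op x y \<in> carrier A"
    and [simp]: "x \<in> carrier A" "y \<in> carrier A"
  shows "cls (op (SOME u. u \<in> cls x) (SOME v. v \<in> cls y)) = cls (op x y)"
proof -
  let ?x = "SOME u. u \<in> cls x" and ?y = "SOME v. v \<in> cls y"
  note [simp] = rep_cls closed
  have "?x \<sqsubseteq>\<^sub>G x" "x \<sqsubseteq>\<^sub>G ?x" "?y \<sqsubseteq>\<^sub>G y" "y \<sqsubseteq>\<^sub>G ?y"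
    by (rule rep_cls; simp)+
  \<comment> \<open>Representatives are exchanged one argument at a time; commutativity reduces the
    second argument to the first.\<close>
  then have "op ?x ?y \<sqsubseteq>\<^sub>G op x ?y" "op x ?y \<sqsubseteq>\<^sub>G op x y"
    "op x y \<sqsubseteq>\<^sub>G op ?x y" "op ?x y \<sqsubseteq>\<^sub>G op ?x ?y"
    using mono comm by (metis rep_cls(1) \<open>x \<in> carrier A\<close> \<open>y \<in> carrier A\<close>)+
  then show ?thesis
    using below_trans[of "op ?x ?y" "op x ?y" "op x y"]
      below_trans[of "op x y" "op ?x y" "op ?x ?y"]
    by (simp add: cls_eq_iff del: Image_singleton_iff)
qed

lemma quotient_simps:
  "carrier Q = cls ` carrier A"
  "\<one>\<^bsub>Q\<^esub> = cls \<one>"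
  "\<lbrakk>x \<in> carrier A; y \<in> carrier A\<rbrakk> \<Longrightarrow> cls x \<otimes>\<^bsub>Q\<^esub> cls y = cls (x \<otimes> y)"
  "\<lbrakk>x \<in> carrier A; y \<in> carrier A\<rbrakk> \<Longrightarrow> cls x \<triangle>\<^bsub>Q\<^esub> cls y = cls (x \<triangle> y)"
  "\<lbrakk>x \<in> carrier A; y \<in> carrier A\<rbrakk> \<Longrightarrow> cls x \<nabla>\<^bsub>Q\<^esub> cls y = cls (x \<nabla> y)"
  "x \<in> carrier A \<Longrightarrow> neg\<^bsub>Q\<^esub> cls x = cls (neg x)"
proof -
  show "carrier Q = cls ` carrier A"
    by (auto simp: quotient_irl_def quotient_def)
  show "\<lbrakk>x \<in> carrier A; y \<in> carrier A\<rbrakk> \<Longrightarrow> cls x \<otimes>\<^bsub>Q\<^esub> cls y = cls (x \<otimes> y)"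
    using cls_compatible[of "\<lambda>x y. x \<otimes> y", OF below_mult m_comm] by (simp add: quotient_irl_def)
  show "\<lbrakk>x \<in> carrier A; y \<in> carrier A\<rbrakk> \<Longrightarrow> cls x \<triangle>\<^bsub>Q\<^esub> cls y = cls (x \<triangle> y)"
    using cls_compatible[of "\<lambda>x y. x \<triangle> y", OF below_lmeet lmeet_comm]
    by (simp add: quotient_irl_def)
  show "\<lbrakk>x \<in> carrier A; y \<in> carrier A\<rbrakk> \<Longrightarrow> cls x \<nabla>\<^bsub>Q\<^esub> cls y = cls (x \<nabla> y)"
    using cls_compatible[of "\<lambda>x y. x \<nabla> y", OF below_ljoin ljoin_comm]
    by (simp add: quotient_irl_def)
  show "neg\<^bsub>Q\<^esub> cls x = cls (neg x)" if "x \<in> carrier A"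
  proof -
    show ?thesis
      using that rep_cls[OF that]
      by (simp add: quotient_irl_def cls_eq_iff below_neg del: Image_singleton_iff)
  qed
qed (simp add: quotient_irl_def)

text \<open>Reduces inequalities in \<open>Q\<close> to membership of an implication in
  \<open>G\<close>.\<close>

lemma quotient_leq_iff:
  assumes [simp]: "x \<in> carrier A" "y \<in> carrier A"
  shows "cls x \<preceq>\<^bsub>Q\<^esub> cls y \<longleftrightarrow> x \<sqsubseteq>\<^sub>G y"
proof
  assume "cls x \<preceq>\<^bsub>Q\<^esub> cls y"
  then have "x \<sqsubseteq>\<^sub>G x \<triangle> y"
    by (simp add: leq_def quotient_simps cls_eq_iff)
  moreover have "x \<triangle> y \<sqsubseteq>\<^sub>G y"
    by (simp add: leq_imp_below lmeet_leq2)
  ultimately show "x \<sqsubseteq>\<^sub>G y"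
    by (rule below_trans) auto
next
  assume "x \<sqsubseteq>\<^sub>G y"
  then have "x \<triangle> x \<sqsubseteq>\<^sub>G y \<triangle> x"
    by (rule below_lmeet) auto
  moreover have "x \<triangle> y \<sqsubseteq>\<^sub>G x"
    by (simp add: leq_imp_below lmeet_leq1)
  ultimately show "cls x \<preceq>\<^bsub>Q\<^esub> cls y"
    by (simp add: leq_def quotient_simps cls_eq_iff lmeet_idem lmeet_comm[of y])
qed

lemma De_Morgan_quotient: "De_Morgan_monoid Q"
proof unfold_locales
  fix X Y Z assume "X \<in> carrier Q" "Y \<in> carrier Q" "Z \<in> carrier Q"
  then obtain x y z where [simp]: "x \<in> carrier A" "y \<in> carrier A" "z \<in> carrier A"
    and XYZ: "X = cls x" "Y = cls y" "Z = cls z"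
    by (auto simp: quotient_simps)
  \<comment> \<open>The two inequalities to be compared say that these implications lie in
    \<open>G\<close>, and the implications coincide already in \<open>A\<close>.\<close>
  have "(x \<otimes> y) \<rightharpoonup> z = (neg z \<otimes> y) \<rightharpoonup> neg x"
    by (simp add: irl_imp_def m_ac)
  then show "X \<otimes>\<^bsub>Q\<^esub> Y \<preceq>\<^bsub>Q\<^esub> Z \<longleftrightarrow> neg\<^bsub>Q\<^esub> Z \<otimes>\<^bsub>Q\<^esub> Y \<preceq>\<^bsub>Q\<^esub> neg\<^bsub>Q\<^esub> X"
    by (simp add: XYZ quotient_simps(3,6) quotient_leq_iff)
next
  show "Defs.square_increasing Q"
    by (auto simp: Defs.square_increasing_def quotient_simps quotient_leq_iff leq_square
        leq_imp_below)
next
  show "Defs.distributive Q"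
    by (auto simp: Defs.distributive_def quotient_simps lmeet_ljoin_distrib)
qed ((auto simp: quotient_simps m_assoc lmeet_assoc ljoin_assoc lmeet_absorb ljoin_absorb; fail)
    | (auto simp: quotient_simps m_comm lmeet_comm ljoin_comm; fail))+

lemma quotient_derived:
  "irl_f Q = cls ff" "irl_0 Q = cls (irl_0 A)"
  "\<lbrakk>x \<in> carrier A; y \<in> carrier A\<rbrakk> \<Longrightarrow> irl_imp Q (cls x) (cls y) = cls (x \<rightharpoonup> y)"
  by (simp_all add: irl_f_def irl_0_def irl_imp_def quotient_simps)

end

section \<open>Algebras in M with join-prime identity\<close>

locale M_algebra = De_Morgan_monoid +
  assumes in_M: "in_M A"
begin

abbreviation tt where "tt \<equiv> ff \<otimes> ff"
abbreviation bb where "bb \<equiv> irl_0 A"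

lemma leq_tt: "x \<in> carrier A \<Longrightarrow> x \<preceq> tt"
  using in_M by (simp add: in_M_def anti_idempotent_def)

lemma M_equation:
  "x \<in> carrier A \<Longrightarrow> ((ff \<rightharpoonup> x) \<nabla> (x \<rightharpoonup> \<one>)) \<rightharpoonup> bb = bb"
  using in_M by (simp add: in_M_def)

lemma neg_bb [simp]: "neg bb = tt" and neg_tt [simp]: "neg tt = bb"
  by (simp_all add: irl_0_def)

lemma bb_leq: "x \<in> carrier A \<Longrightarrow> bb \<preceq> x"
  using neg_leq_neg_iff[of bb x] leq_tt[of "neg x"] by simp

lemma tt_square: "tt \<otimes> tt = tt"
  by (rule leq_antisym[OF leq_tt leq_square]) auto

text \<open>Used later to see that a filter whose congruence identifies the bounds contains
  \<open>bb\<close>.\<close>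

lemma tt_imp_bb: "tt \<rightharpoonup> bb = bb"
  by (simp add: irl_imp_def tt_square)

lemma leq_bb: "\<lbrakk>x \<preceq> bb; x \<in> carrier A\<rbrakk> \<Longrightarrow> x = bb"
  by (rule leq_antisym) (auto simp: bb_leq)

lemma tt_leq: "\<lbrakk>tt \<preceq> x; x \<in> carrier A\<rbrakk> \<Longrightarrow> x = tt"
  by (rule leq_antisym) (auto simp: leq_tt)

lemma mult_bb [simp]: "x \<in> carrier A \<Longrightarrow> x \<otimes> bb = bb"
  by (rule leq_bb) (auto simp: irl_residuation bb_leq)

lemma bb_mult [simp]: "x \<in> carrier A \<Longrightarrow> bb \<otimes> x = bb"
  by (simp add: m_comm)

end

text \<open>The additional axioms of M are inequalities and an equation, so the projection onto
  classes preserves them.\<close>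

lemma (in De_Morgan_filter) in_M_quotient:
  assumes "in_M A"
  shows "in_M Q"
proof -
  interpret M: M_algebra A
    by unfold_locales fact
  show ?thesis
    unfolding in_M_def anti_idempotent_def quotient_simps(1,2) quotient_derived
    using De_Morgan_quotient De_Morgan_monoid.square_increasing[OF De_Morgan_quotient] assms
    by (auto simp: quotient_simps(3-6) quotient_leq_iff quotient_derived M.leq_tt M.M_equation
        in_M_def simp del: Image_singleton_iff intro!: leq_imp_below)
qed

text \<open>These are the features of a quotient by a prime filter: properness yields
  \<open>nontrivial\<close>, primeness yields \<open>one_prime\<close>.\<close>

locale M_prime_algebra = M_algebra +
  assumes nontrivial: "bb \<noteq> tt"
    and one_prime: "\<lbrakk>x \<in> carrier A; y \<in> carrier A; \<one> \<preceq> x \<nabla> y\<rbrakk> \<Longrightarrow> \<one> \<preceq> x \<or> \<one> \<preceq> y"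
begin

text \<open>
  As \<open>p = x \<otimes> tt\<close> satisfies \<open>p \<otimes> tt = p\<close>, either \<open>e \<preceq> p\<close> gives \<open>tt \<preceq> p\<close>,
  or \<open>p \<preceq> ff\<close> gives \<open>x \<preceq> neg tt\<close>.
\<close>
lemma mult_tt:
  assumes x [simp]: "x \<in> carrier A" and "x \<noteq> bb"
  shows "x \<otimes> tt = tt"
proof -
  have pt: "(x \<otimes> tt) \<otimes> tt = x \<otimes> tt"
    using tt_square by (simp add: m_assoc)
  have "\<one> \<preceq> x \<otimes> tt \<or> \<one> \<preceq> neg (x \<otimes> tt)"
    by (rule one_prime) (auto simp: one_leq_ljoin_neg)
  then show ?thesis
  proof
    assume "\<one> \<preceq> x \<otimes> tt"
    then have "\<one> \<otimes> tt \<preceq> (x \<otimes> tt) \<otimes> tt"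
      by (rule mult_mono) auto
    then show ?thesis
      by (simp add: pt tt_leq)
  next
    assume "\<one> \<preceq> neg (x \<otimes> tt)"
    then have "x \<otimes> tt \<preceq> ff"
      by (simp add: mult_leq_neg_iff)
    then have "x \<preceq> neg tt"
      by (subst mult_leq_neg_iff) auto
    then show ?thesis
      using \<open>x \<noteq> bb\<close> leq_bb by simp
  qed
qed

text \<open>Multiply by \<open>tt\<close>: two uses of \<open>mult_tt\<close> give
  \<open>tt\<close>, whereas a product equal to \<open>bb\<close> would stay
  \<open>bb\<close>.\<close>

lemma mult_neq_bb:
  assumes [simp]: "x \<in> carrier A" "y \<in> carrier A" and "x \<noteq> bb" "y \<noteq> bb"
  shows "x \<otimes> y \<noteq> bb"
proof
  assume "x \<otimes> y = bb"
  then have "x \<otimes> (y \<otimes> tt) = bb"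
    by (simp flip: m_assoc)
  then show False
    using assms nontrivial by (simp add: mult_tt)
qed

lemma neq_bb_mono: "\<lbrakk>x \<preceq> y; x \<noteq> bb; x \<in> carrier A; y \<in> carrier A\<rbrakk> \<Longrightarrow> y \<noteq> bb"
  using leq_bb by blast

text \<open>The largest \<open>u\<close> with \<open>u \<otimes> x \<preceq> neg y\<close> is
  \<open>neg (x \<otimes> y)\<close>, so a nonzero such \<open>u\<close> exists exactly when this
  element is not \<open>bb\<close>.\<close>

lemma mult_neq_tt_iff:
  assumes [simp]: "x \<in> carrier A" "y \<in> carrier A"
  shows "x \<otimes> y \<noteq> tt \<longleftrightarrow> (\<exists>u\<in>carrier A. u \<noteq> bb \<and> u \<otimes> x \<preceq> neg y)"
proof -
  have *: "u \<otimes> x \<preceq> neg y \<longleftrightarrow> u \<preceq> neg (x \<otimes> y)" if "u \<in> carrier A" for u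
    using irl_residuation[of x u "neg y"] that by (simp add: m_comm irl_imp_def)
  show ?thesis
  proof
    assume "x \<otimes> y \<noteq> tt"
    then have "neg (x \<otimes> y) \<noteq> bb"
      using neg_neg[of "x \<otimes> y"] by (metis assms m_closed neg_bb)
    then show "\<exists>u\<in>carrier A. u \<noteq> bb \<and> u \<otimes> x \<preceq> neg y"
      by (intro bexI[of _ "neg (x \<otimes> y)"]) (auto simp: *)
  next
    assume "\<exists>u\<in>carrier A. u \<noteq> bb \<and> u \<otimes> x \<preceq> neg y"
    then obtain u where "u \<in> carrier A" "u \<noteq> bb" "u \<preceq> neg (x \<otimes> y)"
      using * by blast
    then show "x \<otimes> y \<noteq> tt"
      using leq_bb[of u] by auto
  qed
qed

text \<open>In the skew reflection to be recovered, these are the elements of the Dunn monoid.\<close>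
definition core :: "'a set"
  where "core = {x \<in> carrier A. x \<noteq> bb \<and> (\<exists>u\<in>carrier A. u \<noteq> bb \<and> u \<otimes> x \<preceq> \<one>)}"

section \<open>Closure properties of the core\<close>

lemma core_closed [simp]: "x \<in> core \<Longrightarrow> x \<in> carrier A"
  and core_neq_bb: "x \<in> core \<Longrightarrow> x \<noteq> bb"
  unfolding core_def by blast+

lemma coreI:
  "\<lbrakk>x \<in> carrier A; u \<in> carrier A; x \<noteq> bb; u \<noteq> bb; u \<otimes> x \<preceq> \<one>\<rbrakk> \<Longrightarrow> x \<in> core"
  unfolding core_def by blast

text \<open>The condition \<open>u \<otimes> x \<preceq> \<one>\<close> is symmetric in
  \<open>u\<close> and \<open>x\<close>, so the witness belongs to the core itself.\<close>

lemma coreE: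
  assumes "x \<in> core"
  obtains u where "u \<in> core" "u \<otimes> x \<preceq> \<one>"
proof -
  obtain u where u: "u \<in> carrier A" "u \<noteq> bb" "u \<otimes> x \<preceq> \<one>"
    using assms unfolding core_def by blast
  then have "u \<in> core"
    using assms by (intro coreI[of u x]) (simp_all add: m_comm core_neq_bb)
  then show ?thesis
    using u that by blast
qed

lemma one_neq_bb: "\<one> \<noteq> bb"
proof
  assume "\<one> = bb"
  then have "\<one> \<otimes> tt = bb \<otimes> tt"
    by simp
  then show False
    using nontrivial by simp
qed

lemma f_neq_bb: "ff \<noteq> bb"
proof
  assume "ff = bb"
  then have "tt = bb \<otimes> bb"
    by simp
  then show False
    using nontrivial by simp
qed

lemma one_core: "\<one> \<in> core"
  using one_neq_bb by (intro coreI[of _ \<one>]) auto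

lemma core_lower: "\<lbrakk>x \<preceq> y; x \<noteq> bb; x \<in> carrier A; y \<in> core\<rbrakk> \<Longrightarrow> x \<in> core"
proof -
  assume *: "x \<preceq> y" "x \<noteq> bb" "x \<in> carrier A" "y \<in> core"
  then obtain u where "u \<in> core" "u \<otimes> y \<preceq> \<one>"
    by (blast elim: coreE)
  then show "x \<in> core"
    using * leq_trans[OF mult_mono1[of x y u]] by (intro coreI[of x u]) (auto simp: core_neq_bb)
qed

text \<open>The product of the two witnesses is a witness, nonzero by
  \<open>mult_neq_bb\<close>.\<close>

lemma core_mult:
  assumes x: "x \<in> core" and y: "y \<in> core"
  shows "x \<otimes> y \<in> core"
proof -
  obtain u where u: "u \<in> core" "u \<otimes> x \<preceq> \<one>" using x by (rule coreE)
  obtain v where v: "v \<in> core" "v \<otimes> y \<preceq> \<one>" using y by (rule coreE)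
  have "(u \<otimes> x) \<otimes> (v \<otimes> y) \<preceq> \<one> \<otimes> \<one>"
    using assms u v by (intro mult_mono) auto
  then have "(u \<otimes> v) \<otimes> (x \<otimes> y) \<preceq> \<one>"
    using assms u v by (simp add: m_ac)
  then show ?thesis
    using assms u v by (intro coreI[of _ "u \<otimes> v"]) (auto simp: mult_neq_bb core_neq_bb)
qed

text \<open>If \<open>u \<otimes> x \<preceq> e\<close> then also \<open>u \<otimes> x \<preceq> u \<otimes> x \<otimes> x \<preceq> x\<close>.\<close>
lemma core_lmeet_one:
  assumes x: "x \<in> core"
  shows "x \<triangle> \<one> \<in> core"
proof -
  obtain u where u: "u \<in> core" "u \<otimes> x \<preceq> \<one>" using x by (rule coreE)
  note [simp] = core_closed[OF x] core_closed[OF u(1)]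
  have "u \<otimes> x \<preceq> u \<otimes> (x \<otimes> x)"
    by (intro mult_mono1 leq_square) auto
  also have "u \<otimes> (x \<otimes> x) \<preceq> x"
    using mult_mono[OF u(2), of x x] by (simp add: m_assoc)
  finally have "u \<otimes> x \<preceq> x"
    by simp
  then have "u \<otimes> x \<preceq> x \<triangle> \<one>"
    using u by (intro leq_lmeet) auto
  then have "x \<triangle> \<one> \<noteq> bb"
    using core_neq_bb[OF core_mult[OF u(1) x]] by (rule neq_bb_mono) auto
  then show ?thesis
    by (intro core_lower[OF lmeet_leq1 _ _ x]) auto
qed

text \<open>Truncating both elements at \<open>e\<close> makes their product a nonzero lower bound
  of \<open>x\<close> and \<open>y\<close>.\<close>

lemma core_lmeet:
  assumes x: "x \<in> core" and y: "y \<in> core"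
  shows "x \<triangle> y \<in> core"
proof -
  note [simp] = core_closed[OF x] core_closed[OF y]
  have "(x \<triangle> \<one>) \<otimes> (y \<triangle> \<one>) \<preceq> x \<otimes> \<one>" "(x \<triangle> \<one>) \<otimes> (y \<triangle> \<one>) \<preceq> \<one> \<otimes> y"
    by (intro mult_mono; simp add: lmeet_leq1 lmeet_leq2)+
  then have "(x \<triangle> \<one>) \<otimes> (y \<triangle> \<one>) \<preceq> x \<triangle> y"
    by (intro leq_lmeet) auto
  then have "x \<triangle> y \<noteq> bb"
    using core_neq_bb[OF core_mult[OF core_lmeet_one[OF x] core_lmeet_one[OF y]]]
    by (rule neq_bb_mono) auto
  then show ?thesis
    by (intro core_lower[OF lmeet_leq1 _ _ x]) auto
qed

text \<open>The meet of the two witnesses serves both elements, and \<open>core_lmeet\<close> keeps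
  it nonzero.\<close>

lemma core_ljoin:
  assumes x: "x \<in> core" and y: "y \<in> core"
  shows "x \<nabla> y \<in> core"
proof -
  obtain u where u: "u \<in> core" "u \<otimes> x \<preceq> \<one>" using x by (rule coreE)
  obtain v where v: "v \<in> core" "v \<otimes> y \<preceq> \<one>" using y by (rule coreE)
  note [simp] = core_closed[OF x] core_closed[OF y] core_closed[OF u(1)] core_closed[OF v(1)]
  have "(u \<triangle> v) \<otimes> x \<preceq> u \<otimes> x" "(u \<triangle> v) \<otimes> y \<preceq> v \<otimes> y"
    by (intro mult_mono; simp add: lmeet_leq1 lmeet_leq2)+
  then have "(u \<triangle> v) \<otimes> x \<preceq> \<one>" "(u \<triangle> v) \<otimes> y \<preceq> \<one>"
    using leq_trans[OF _ u(2)] leq_trans[OF _ v(2)] by simp_all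
  then have "x \<nabla> y \<preceq> (u \<triangle> v) \<rightharpoonup> \<one>"
    by (intro ljoin_leq) (auto simp: irl_residuation)
  then have "(u \<triangle> v) \<otimes> (x \<nabla> y) \<preceq> \<one>"
    by (simp add: irl_residuation)
  moreover have "x \<nabla> y \<noteq> bb"
    using core_neq_bb[OF x] by (intro neq_bb_mono[OF leq_ljoin1, of x]) auto
  ultimately show ?thesis
    using core_neq_bb[OF core_lmeet[OF u(1) v(1)]] by (intro coreI[of _ "u \<triangle> v"]) auto
qed

text \<open>With witnesses \<open>u\<close> for \<open>x\<close> and \<open>v\<close> for
  \<open>y\<close>, the implication is nonzero because it lies above
  \<open>u \<otimes> (y \<triangle> \<one>)\<close>, and modus ponens makes
  \<open>v \<otimes> x\<close> a witness for it.\<close>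

lemma core_imp:
  assumes x: "x \<in> core" and y: "y \<in> core"
  shows "x \<rightharpoonup> y \<in> core"
proof -
  obtain u where u: "u \<in> core" "u \<otimes> x \<preceq> \<one>" using x by (rule coreE)
  obtain v where v: "v \<in> core" "v \<otimes> y \<preceq> \<one>" using y by (rule coreE)
  note [simp] = core_closed[OF x] core_closed[OF y] core_closed[OF u(1)] core_closed[OF v(1)]
  have "(u \<otimes> x) \<otimes> (y \<triangle> \<one>) \<preceq> \<one> \<otimes> y"
    using u(2) by (intro mult_mono) (auto simp: lmeet_leq1)
  then have "u \<otimes> (y \<triangle> \<one>) \<preceq> x \<rightharpoonup> y"
    by (simp add: m_ac flip: irl_residuation)
  then have "x \<rightharpoonup> y \<noteq> bb"
    using core_neq_bb[OF core_mult[OF u(1) core_lmeet_one[OF y]]] by (rule neq_bb_mono) auto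
  moreover have "v \<otimes> (x \<otimes> (x \<rightharpoonup> y)) \<preceq> \<one>"
    using leq_trans[OF mult_mono1[OF irl_imp_mp] v(2)] by simp
  ultimately show ?thesis
    using core_neq_bb[OF core_mult[OF v(1) x]]
    by (intro coreI[of _ "v \<otimes> x"]) (auto simp: m_assoc)
qed

section \<open>The core and the negations of its elements\<close>

lemma f_notin_core: "ff \<notin> core"
proof
  assume "ff \<in> core"
  then obtain u where "u \<in> core" "u \<otimes> ff \<preceq> \<one>"
    by (rule coreE)
  \<comment> \<open>Since \<open>e\<close> is \<open>neg ff\<close>, the witness has the form
    required by \<open>mult_neq_tt_iff\<close>.\<close>
  then have "\<exists>u\<in>carrier A. u \<noteq> bb \<and> u \<otimes> ff \<preceq> neg ff"
    using core_neq_bb[of u] by (intro bexI[of _ u]) (auto simp: irl_f_def)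
  then have "ff \<otimes> ff \<noteq> tt"
    using mult_neq_tt_iff[of ff ff] by blast
  then show False
    by simp
qed

lemma tt_notin_core: "tt \<notin> core"
  using core_lower[OF leq_tt f_neq_bb] f_notin_core irl_f_closed by blast

text \<open>Contraposing \<open>u \<otimes> neg x \<preceq> \<one>\<close> gives
  \<open>u \<otimes> ff \<preceq> x\<close>, so a witness for \<open>neg x\<close> times one for
  \<open>x\<close> would put \<open>ff\<close> into the core.\<close>

lemma core_neg:
  assumes x: "x \<in> core"
  shows "neg x \<notin> core"
proof
  assume "neg x \<in> core"
  then obtain u where u: "u \<in> core" "u \<otimes> neg x \<preceq> \<one>" by (rule coreE)
  obtain v where v: "v \<in> core" "v \<otimes> x \<preceq> \<one>" using x by (rule coreE)
  note [simp] = core_closed[OF x] core_closed[OF u(1)] core_closed[OF v(1)]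
  have "u \<otimes> ff \<preceq> x"
    using u(2) neg_residuation[of "neg x" u \<one>] by (simp add: m_comm irl_f_def)
  then have "v \<otimes> (u \<otimes> ff) \<preceq> \<one>"
    using leq_trans[OF mult_mono1 v(2)] by simp
  then have "ff \<in> core"
    using f_neq_bb core_neq_bb[OF core_mult[OF v(1) u(1)]]
    by (intro coreI[of _ "v \<otimes> u"]) (auto simp: m_assoc)
  then show False
    using f_notin_core by simp
qed

text \<open>Here the equation defining M is decisive: once \<open>x \<rightharpoonup> \<one>\<close>
  is \<open>bb\<close>, the join reduces to \<open>ff \<rightharpoonup> x\<close>, which cannot be
  \<open>bb\<close> because \<open>bb \<rightharpoonup> bb\<close> is \<open>tt\<close>. This
  element is a witness for \<open>neg x\<close>.\<close>

lemma core_cover: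
  assumes [simp]: "x \<in> carrier A" and x: "x \<noteq> bb" "x \<noteq> tt" "x \<notin> core"
  shows "neg x \<in> core"
proof -
  have nx: "neg x \<noteq> bb"
    using x(2) by (metis assms(1) neg_bb neg_neg)
  \<comment> \<open>Otherwise this implication would be a witness for \<open>x\<close>.\<close>
  have "x \<rightharpoonup> \<one> = bb"
    using x by (rule_tac ccontr) (auto simp: m_comm irl_imp_mp dest: coreI[of x "x \<rightharpoonup> \<one>", rotated 3])
  then have "(ff \<rightharpoonup> x) \<rightharpoonup> bb = bb"
    using M_equation[of x] leq_iff_ljoin[of bb "ff \<rightharpoonup> x"] bb_leq by (simp add: ljoin_comm)
  moreover have "bb \<rightharpoonup> bb = tt"
    by (simp add: irl_imp_def)
  ultimately have u: "ff \<rightharpoonup> x \<noteq> bb"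
    using nontrivial by metis
  have "(ff \<rightharpoonup> x) \<otimes> ff \<preceq> x"
    by (simp add: m_comm irl_imp_mp)
  then have "(ff \<rightharpoonup> x) \<otimes> neg x \<preceq> \<one>"
    using neg_residuation[of ff "ff \<rightharpoonup> x" x] by (simp add: m_comm irl_f_def)
  then show ?thesis
    using nx u by (intro coreI[of _ "ff \<rightharpoonup> x"]) auto
qed

text \<open>Otherwise some nonzero \<open>u\<close> satisfies
  \<open>u \<otimes> neg x \<preceq> y\<close>, and a witness for \<open>y\<close> times
  \<open>u\<close> is a witness for \<open>neg x\<close>, against \<open>core_neg\<close>.\<close>

lemma core_refl_mult:
  assumes x: "x \<in> core" and y: "y \<in> core"
  shows "neg x \<otimes> neg y = tt"
proof (rule ccontr)
  assume "\<not> ?thesis"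
  then obtain u where u: "u \<in> carrier A" "u \<noteq> bb" "u \<otimes> neg x \<preceq> y"
    using x y mult_neq_tt_iff[of "neg x" "neg y"] by auto
  obtain v where v: "v \<in> core" "v \<otimes> y \<preceq> \<one>" using y by (rule coreE)
  note [simp] = core_closed[OF x] core_closed[OF y] u(1) core_closed[OF v(1)]
  have "v \<otimes> (u \<otimes> neg x) \<preceq> \<one>"
    using leq_trans[OF mult_mono1[OF u(3), of v] v(2)] by simp
  moreover have "neg x \<noteq> bb"
    using tt_notin_core x by (metis \<open>x \<in> carrier A\<close> neg_bb neg_neg)
  ultimately have "neg x \<in> core"
    using mult_neq_bb[of v u] u(2) core_neq_bb[OF v(1)]
    by (intro coreI[of _ "v \<otimes> u"]) (auto simp: m_assoc)
  then show False
    using core_neg[OF x] by simp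
qed

end

section \<open>Recognizing skew reflections\<close>

definition irl_hom :: "'a irl \<Rightarrow> 'c irl \<Rightarrow> ('a \<Rightarrow> 'c) set"
  where "irl_hom A C = {h \<in> hom A C.
    h \<one>\<^bsub>A\<^esub> = \<one>\<^bsub>C\<^esub> \<and>
    (\<forall>x\<in>carrier A. h (neg\<^bsub>A\<^esub> x) = neg\<^bsub>C\<^esub> (h x)) \<and>
    (\<forall>x\<in>carrier A. \<forall>y\<in>carrier A.
      h (x \<triangle>\<^bsub>A\<^esub> y) = h x \<triangle>\<^bsub>C\<^esub> h y \<and> h (x \<nabla>\<^bsub>A\<^esub> y) = h x \<nabla>\<^bsub>C\<^esub> h y)}"

lemma irl_iso_eq: "irl_iso A C = {h \<in> irl_hom A C. bij_betw h (carrier A) (carrier C)}"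
  unfolding irl_iso_def irl_hom_def by blast

lemma irl_homI:
  assumes "\<And>x. x \<in> carrier A \<Longrightarrow> h x \<in> carrier C"
    and "\<And>x y. \<lbrakk>x \<in> carrier A; y \<in> carrier A\<rbrakk> \<Longrightarrow> h (x \<otimes>\<^bsub>A\<^esub> y) = h x \<otimes>\<^bsub>C\<^esub> h y"
    and "h \<one>\<^bsub>A\<^esub> = \<one>\<^bsub>C\<^esub>"
    and "\<And>x. x \<in> carrier A \<Longrightarrow> h (neg\<^bsub>A\<^esub> x) = neg\<^bsub>C\<^esub> (h x)"
    and "\<And>x y. \<lbrakk>x \<in> carrier A; y \<in> carrier A\<rbrakk> \<Longrightarrow> h (x \<triangle>\<^bsub>A\<^esub> y) = h x \<triangle>\<^bsub>C\<^esub> h y"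
    and "\<And>x y. \<lbrakk>x \<in> carrier A; y \<in> carrier A\<rbrakk> \<Longrightarrow> h (x \<nabla>\<^bsub>A\<^esub> y) = h x \<nabla>\<^bsub>C\<^esub> h y"
  shows "h \<in> irl_hom A C"
  using assms by (simp add: irl_hom_def hom_def Pi_def)

lemma irl_homD:
  assumes "h \<in> irl_hom A C"
  shows "x \<in> carrier A \<Longrightarrow> h x \<in> carrier C"
    and "\<lbrakk>x \<in> carrier A; y \<in> carrier A\<rbrakk> \<Longrightarrow> h (x \<otimes>\<^bsub>A\<^esub> y) = h x \<otimes>\<^bsub>C\<^esub> h y"
    and "h \<one>\<^bsub>A\<^esub> = \<one>\<^bsub>C\<^esub>"
    and "x \<in> carrier A \<Longrightarrow> h (neg\<^bsub>A\<^esub> x) = neg\<^bsub>C\<^esub> (h x)"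
    and "\<lbrakk>x \<in> carrier A; y \<in> carrier A\<rbrakk> \<Longrightarrow> h (x \<triangle>\<^bsub>A\<^esub> y) = h x \<triangle>\<^bsub>C\<^esub> h y"
    and "\<lbrakk>x \<in> carrier A; y \<in> carrier A\<rbrakk> \<Longrightarrow> h (x \<nabla>\<^bsub>A\<^esub> y) = h x \<nabla>\<^bsub>C\<^esub> h y"
  using assms by (auto simp: irl_hom_def hom_def Pi_def)

lemma irl_hom_compose:
  "\<lbrakk>g \<in> irl_hom A B; h \<in> irl_hom B C\<rbrakk> \<Longrightarrow> (\<lambda>x. h (g x)) \<in> irl_hom A C"
  by (rule irl_homI) (simp_all add: irl_homD)

lemma skew_carrier_cases:
  assumes "s \<in> skew_carrier B"
  obtains "s = Zero" | "s = One" | x where "x \<in> carrier B" "s = Base x"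
    | x where "x \<in> carrier B" "s = Refl x"
  using assms by (auto simp: skew_carrier_def)

lemma skew_carrier_iff [simp]:
  "Zero \<in> skew_carrier B" "One \<in> skew_carrier B"
  "Base x \<in> skew_carrier B \<longleftrightarrow> x \<in> carrier B" "Refl x \<in> skew_carrier B \<longleftrightarrow> x \<in> carrier B"
  by (auto simp: skew_carrier_def)

text \<open>The universal properties of meet and join, phrased directly in terms of
  \<open>r\<close>.\<close>

lemma skew_lattice_ops:
  assumes "skew_order B r" and s: "s \<in> skew_carrier B" and t: "t \<in> skew_carrier B"
  defines "M \<equiv> s \<triangle>\<^bsub>skew_algebra B r\<^esub> t" and "J \<equiv> s \<nabla>\<^bsub>skew_algebra B r\<^esub> t"
  shows "M \<in> skew_carrier B" "r M s" "r M t"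
    "\<And>u. \<lbrakk>u \<in> skew_carrier B; r u s; r u t\<rbrakk> \<Longrightarrow> r u M"
    "J \<in> skew_carrier B" "r s J" "r t J"
    "\<And>u. \<lbrakk>u \<in> skew_carrier B; r s u; r t u\<rbrakk> \<Longrightarrow> r J u"
proof -
  interpret lattice "skew_gorder B r"
    using assms(1) by (simp add: skew_order_def)
  have MJ: "M = Lattice.meet (skew_gorder B r) s t" "J = Lattice.join (skew_gorder B r) s t"
    by (simp_all add: M_def J_def skew_algebra_def)
  show "M \<in> skew_carrier B" "r M s" "r M t" "J \<in> skew_carrier B" "r s J" "r t J"
    using meet_closed[of s t] meet_left[of s t] meet_right[of s t]
      join_closed[of s t] join_left[of s t] join_right[of s t] s t by (simp_all add: MJ)
  show "\<And>u. \<lbrakk>u \<in> skew_carrier B; r u s; r u t\<rbrakk> \<Longrightarrow> r u M"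
    using meet_le[of _ s t] s t by (simp add: MJ)
  show "\<And>u. \<lbrakk>u \<in> skew_carrier B; r s u; r t u\<rbrakk> \<Longrightarrow> r J u"
    using join_le[of s _ t] s t by (simp add: MJ)
qed

section \<open>The isomorphism onto a skew reflection of the core\<close>

context M_prime_algebra
begin

definition core_rl :: "'a rl"
  where "core_rl = \<lparr>carrier = core, monoid.mult = monoid.mult A, one = \<one>, lmeet = lmeet A,
    ljoin = ljoin A, imp = irl_imp A\<rparr>"

lemma core_rl_simps [simp]:
  "carrier core_rl = core" "x \<otimes>\<^bsub>core_rl\<^esub> y = x \<otimes> y" "\<one>\<^bsub>core_rl\<^esub> = \<one>"
  "x \<triangle>\<^bsub>core_rl\<^esub> y = x \<triangle> y" "x \<nabla>\<^bsub>core_rl\<^esub> y = x \<nabla> y" "x \<leadsto>\<^bsub>core_rl\<^esub> y = x \<rightharpoonup> y"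
  "x \<preceq>\<^bsub>core_rl\<^esub> y \<longleftrightarrow> x \<preceq> y"
  by (simp_all add: core_rl_def leq_def)

text \<open>By closure under implication, the residual of the whole algebra serves as that of the
  core.\<close>

lemma Dunn_core: "Dunn_monoid core_rl"
proof unfold_locales
  show "Defs.square_increasing core_rl"
    by (simp add: Defs.square_increasing_def leq_square)
  show "Defs.distributive core_rl"
    by (simp add: Defs.distributive_def lmeet_ljoin_distrib)
qed ((simp add: core_mult core_lmeet core_ljoin core_imp one_core m_assoc lmeet_assoc ljoin_assoc
      lmeet_absorb ljoin_absorb irl_residuation; fail)
    | (simp add: m_comm lmeet_comm ljoin_comm; fail))+

text \<open>The inverse of the intended isomorphism; the order of the skew reflection is pulled back
  along it.\<close>

fun unskew :: "'a skew \<Rightarrow> 'a"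
  where
    "unskew Zero = bb"
  | "unskew One = tt"
  | "unskew (Base x) = x"
  | "unskew (Refl x) = neg x"

abbreviation S where "S \<equiv> skew_carrier core_rl"
abbreviation core_order where "core_order s t \<equiv> unskew s \<preceq> unskew t"
abbreviation core_skew where "core_skew \<equiv> skew_algebra core_rl core_order"

lemma skew_cases:
  assumes "s \<in> S"
  obtains "s = Zero" | "s = One" | x where "x \<in> core" "s = Base x"
    | x where "x \<in> core" "s = Refl x"
  using skew_carrier_cases[OF assms] unfolding core_rl_simps by blast

lemma unskew_closed [simp]: "s \<in> S \<Longrightarrow> unskew s \<in> carrier A"
  by (erule skew_cases) auto

lemma neg_inject: "\<lbrakk>neg x = neg y; x \<in> carrier A; y \<in> carrier A\<rbrakk> \<Longrightarrow> x = y"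
  by (metis neg_neg)

lemma core_neg_neq:
  assumes "x \<in> core"
  shows "neg x \<noteq> bb" "neg x \<noteq> tt" "x \<noteq> bb" "x \<noteq> tt"
proof -
  show "x \<noteq> bb" "x \<noteq> tt"
    using core_neq_bb[OF assms] tt_notin_core assms by blast+
  then show "neg x \<noteq> bb" "neg x \<noteq> tt"
    using neg_neg[OF core_closed[OF assms]] neg_bb neg_tt by metis+
qed

text \<open>The four kinds of elements have disjoint images: \<open>core_neg_neq\<close> sets the
  bounds apart, and \<open>core_neg\<close> separates the core from its negations.\<close>

lemma inj_unskew: "inj_on unskew S"
proof (rule inj_onI)
  fix s t assume "s \<in> S" "t \<in> S" and eq: "unskew s = unskew t"
  from this(1) show "s = t"
  proof (cases rule: skew_cases)
    case 1
    from \<open>t \<in> S\<close> show ?thesis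
      by (cases rule: skew_cases) (use eq 1 nontrivial core_neg_neq in force)+
  next
    case 2
    from \<open>t \<in> S\<close> show ?thesis
      by (cases rule: skew_cases) (use eq 2 nontrivial core_neg_neq in force)+
  next
    case (3 x)
    from \<open>t \<in> S\<close> show ?thesis
      by (cases rule: skew_cases) (use eq 3 core_neg core_neg_neq in force)+
  next
    case (4 x)
    from \<open>t \<in> S\<close> show ?thesis
      by (cases rule: skew_cases) (use eq 4 core_neg core_neg_neq neg_inject core_closed in force)+
  qed
qed

lemma unskew_image: "unskew ` S = carrier A"
proof (intro subset_antisym subsetI)
  fix x assume x: "x \<in> carrier A"
  consider "x = bb" | "x = tt" | "x \<in> core" | "neg x \<in> core"
    using core_cover[OF x] by blast
  then have "\<exists>s\<in>S. unskew s = x"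
  proof cases
    case 1 then show ?thesis by (intro bexI[of _ Zero]) auto
  next
    case 2 then show ?thesis by (intro bexI[of _ One]) auto
  next
    case 3 then show ?thesis by (intro bexI[of _ "Base x"]) auto
  next
    case 4 then show ?thesis using x by (intro bexI[of _ "Refl (neg x)"]) auto
  qed
  then show "x \<in> unskew ` S"
    by blast
qed auto

lemma unskew_eqD: "\<lbrakk>unskew s = unskew t; s \<in> S; t \<in> S\<rbrakk> \<Longrightarrow> s = t"
  using inj_unskew by (rule inj_onD)

lemma unskew_surj:
  assumes "x \<in> carrier A"
  obtains s where "s \<in> S" "unskew s = x"
proof -
  have "x \<in> unskew ` S"
    using assms by (simp add: unskew_image)
  then show ?thesis
    using that by blast
qed

text \<open>As \<open>unskew\<close> is a bijection onto \<open>A\<close>, the lattice bounds are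
  preimages of those in \<open>A\<close>.\<close>

lemma skew_order_core: "skew_order core_rl core_order"
  unfolding skew_order_def
proof (intro conjI ballI)
  show "lattice (skew_gorder core_rl core_order)"
  proof unfold_locales
    fix s t assume "s \<in> carrier (skew_gorder core_rl core_order)"
      "t \<in> carrier (skew_gorder core_rl core_order)"
    then have st: "s \<in> S" "t \<in> S"
      by simp_all
    obtain j where "j \<in> S" "unskew j = unskew s \<nabla> unskew t"
      using st by (auto intro: unskew_surj[of "unskew s \<nabla> unskew t"])
    with st show "\<exists>j. least (skew_gorder core_rl core_order) j
        (Upper (skew_gorder core_rl core_order) {s, t})"
      by (intro exI[of _ j]) (auto simp: least_def Upper_def leq_ljoin1 leq_ljoin2 ljoin_leq)
    obtain m where "m \<in> S" "unskew m = unskew s \<triangle> unskew t"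
      using st by (auto intro: unskew_surj[of "unskew s \<triangle> unskew t"])
    with st show "\<exists>m. greatest (skew_gorder core_rl core_order) m
        (Lower (skew_gorder core_rl core_order) {s, t})"
      by (intro exI[of _ m]) (auto simp: greatest_def Lower_def lmeet_leq1 lmeet_leq2 leq_lmeet)
  next
    fix s t
    assume "s \<sqsubseteq>\<^bsub>skew_gorder core_rl core_order\<^esub> t" "t \<sqsubseteq>\<^bsub>skew_gorder core_rl core_order\<^esub> s"
      and "s \<in> carrier (skew_gorder core_rl core_order)"
        "t \<in> carrier (skew_gorder core_rl core_order)"
    then show "s .=\<^bsub>skew_gorder core_rl core_order\<^esub> t"
      using unskew_eqD[of s t] leq_antisym[of "unskew s" "unskew t"] by simp
  next
    fix s t u
    assume "s \<sqsubseteq>\<^bsub>skew_gorder core_rl core_order\<^esub> t" "t \<sqsubseteq>\<^bsub>skew_gorder core_rl core_order\<^esub> u"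
      and "s \<in> carrier (skew_gorder core_rl core_order)"
        "t \<in> carrier (skew_gorder core_rl core_order)"
        "u \<in> carrier (skew_gorder core_rl core_order)"
    then show "s \<sqsubseteq>\<^bsub>skew_gorder core_rl core_order\<^esub> u"
      using leq_trans[of "unskew s" "unskew t" "unskew u"] by simp
  qed auto
next
  fix b c assume "b \<in> carrier core_rl" "c \<in> carrier core_rl"
  then have b: "b \<in> core" and c: "c \<in> core"
    by simp_all
  then have [simp]: "b \<in> carrier A" "c \<in> carrier A"
    by simp_all
  show "core_order (Base b) (Base c) \<longleftrightarrow> b \<preceq>\<^bsub>core_rl\<^esub> c"
    by simp
  show "core_order (Refl b) (Refl c) \<longleftrightarrow> c \<preceq>\<^bsub>core_rl\<^esub> b"
    by (simp add: neg_leq_neg_iff)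
  \<comment> \<open>Both sides amount to \<open>b \<otimes> c \<preceq> ff\<close>.\<close>
  show "core_order (Base b) (Refl c) \<longleftrightarrow>
      core_order (Base \<one>\<^bsub>core_rl\<^esub>) (Refl (b \<otimes>\<^bsub>core_rl\<^esub> c))"
    by (simp add: mult_leq_neg_iff)
  \<comment> \<open>By \<open>core_lower\<close>, the inequality would place \<open>neg b\<close> in
    the core.\<close>
  show "\<not> core_order (Refl b) (Base c)"
    using core_lower[of "neg b" c] core_neg_neq(1)[OF b] core_neg[OF b] c by auto
next
  fix b assume "b \<in> carrier core_rl"
  then have [simp]: "b \<in> carrier A"
    by simp
  show "core_order Zero (Base b)" "core_order (Base b) One"
    "core_order Zero (Refl b)" "core_order (Refl b) One"
    by (simp_all add: bb_leq leq_tt)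
qed

lemma unskew_neg: "s \<in> S \<Longrightarrow> unskew (skew_neg s) = neg (unskew s)"
  by (erule skew_cases) auto

text \<open>Mixed products come from the definition of implication, products with \<open>One\<close>
  from \<open>mult_tt\<close>, and products of two reflected elements from
  \<open>core_refl_mult\<close>.\<close>

lemma unskew_mult:
  assumes s: "s \<in> S" and t: "t \<in> S"
  shows "unskew (skew_mult core_rl s t) = unskew s \<otimes> unskew t"
proof -
  have base_refl: "neg (x \<rightharpoonup> y) = x \<otimes> neg y" if "x \<in> core" "y \<in> core" for x y
    using that by (simp add: irl_imp_def)
  have tt: "tt \<otimes> x = tt" if "x \<in> carrier A" "x \<noteq> bb" for x
    using mult_tt[OF that] that by (simp add: m_comm[of x tt])
  from s show ?thesis
  proof (cases rule: skew_cases)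
    case 1
    then show ?thesis using t by simp
  next
    case 2
    from t show ?thesis
      by (cases rule: skew_cases) (simp_all add: 2 tt_square tt core_neg_neq)
  next
    case (3 x)
    from t show ?thesis
      by (cases rule: skew_cases) (simp_all add: 3 mult_tt core_neg_neq base_refl)
  next
    case (4 x)
    from t show ?thesis
      by (cases rule: skew_cases)
        (simp_all add: 4 mult_tt core_neg_neq base_refl core_refl_mult m_comm[of "neg x"])
  qed
qed

lemma skew_mult_closed: "\<lbrakk>s \<in> S; t \<in> S\<rbrakk> \<Longrightarrow> skew_mult core_rl s t \<in> S"
  by (erule skew_cases; erule skew_cases) (simp_all add: core_mult core_imp)

lemma unskew_lattice:
  assumes st: "s \<in> S" "t \<in> S"
  shows "unskew (s \<triangle>\<^bsub>core_skew\<^esub> t) = unskew s \<triangle> unskew t"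
    and "unskew (s \<nabla>\<^bsub>core_skew\<^esub> t) = unskew s \<nabla> unskew t"
proof -
  note ops = skew_lattice_ops[OF skew_order_core st]
  obtain m where m: "m \<in> S" "unskew m = unskew s \<triangle> unskew t"
    using st by (auto intro: unskew_surj[of "unskew s \<triangle> unskew t"])
  show "unskew (s \<triangle>\<^bsub>core_skew\<^esub> t) = unskew s \<triangle> unskew t"
    using ops(1-3) ops(4)[OF m(1)] st
    by (intro leq_antisym leq_lmeet) (auto simp: m lmeet_leq1 lmeet_leq2)
  obtain j where j: "j \<in> S" "unskew j = unskew s \<nabla> unskew t"
    using st by (auto intro: unskew_surj[of "unskew s \<nabla> unskew t"])
  show "unskew (s \<nabla>\<^bsub>core_skew\<^esub> t) = unskew s \<nabla> unskew t"
    using ops(5-7) ops(8)[OF j(1)] st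
    by (intro leq_antisym ljoin_leq) (auto simp: j leq_ljoin1 leq_ljoin2)
qed

lemma ex_iso_skew_reflection:
  obtains h where "h \<in> irl_hom A core_skew" "bij_betw h (carrier A) (carrier core_skew)"
proof
  let ?h = "the_inv_into S unskew"
  have S: "carrier core_skew = S"
    by (simp add: skew_algebra_def)
  have bij: "bij_betw unskew S (carrier A)"
    using inj_unskew unskew_image by (simp add: bij_betw_def)
  then show "bij_betw ?h (carrier A) (carrier core_skew)"
    unfolding S by (rule bij_betw_the_inv_into)
  have u [simp]: "unskew (?h x) = x" if "x \<in> carrier A" for x
    using that by (simp add: f_the_inv_into_f[OF inj_unskew] unskew_image)
  have h [simp]: "?h x \<in> S" if "x \<in> carrier A" for x
    using that the_inv_into_into[OF inj_unskew] by (simp add: unskew_image)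
  \<comment> \<open>Identities in the skew reflection are verified after applying
    \<open>unskew\<close>.\<close>
  have eq: "?h x = s" if "unskew s = x" "s \<in> S" for x s
    using that the_inv_into_f_f[OF inj_unskew] by blast
  show "?h \<in> irl_hom A core_skew"
  proof (rule irl_homI)
    fix x y assume [simp]: "x \<in> carrier A" "y \<in> carrier A"
    show "?h (x \<otimes> y) = ?h x \<otimes>\<^bsub>core_skew\<^esub> ?h y"
      by (rule eq) (simp_all add: skew_algebra_def unskew_mult skew_mult_closed)
    show "?h (x \<triangle> y) = ?h x \<triangle>\<^bsub>core_skew\<^esub> ?h y"
      using skew_lattice_ops(1)[OF skew_order_core] by (intro eq) (simp_all add: unskew_lattice)
    show "?h (x \<nabla> y) = ?h x \<nabla>\<^bsub>core_skew\<^esub> ?h y"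
      using skew_lattice_ops(5)[OF skew_order_core] by (intro eq) (simp_all add: unskew_lattice)
  next
    fix x assume [simp]: "x \<in> carrier A"
    have "skew_neg (?h x) \<in> S"
      using h[of x] by (auto elim!: skew_cases simp del: h)
    then show "?h (neg x) = neg\<^bsub>core_skew\<^esub> (?h x)"
      by (intro eq) (simp_all add: skew_algebra_def unskew_neg)
  next
    show "?h \<one> = \<one>\<^bsub>core_skew\<^esub>"
      by (intro eq) (simp_all add: skew_algebra_def one_core)
  qed (simp add: S)
qed

end

section \<open>Subdirect representation\<close>

lemma (in De_Morgan_filter) M_prime_quotient:
  assumes "in_M A" and prime: "prime_e_filter A G"
  shows "M_prime_algebra Q"
proof -
  interpret M: M_algebra A
    by unfold_locales fact
  interpret Q: De_Morgan_monoid Q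
    by (rule De_Morgan_quotient)
  show ?thesis
  proof unfold_locales
    show "in_M Q"
      using assms(1) by (rule in_M_quotient)
    show "irl_0 Q \<noteq> irl_f Q \<otimes>\<^bsub>Q\<^esub> irl_f Q"
    proof
      assume "irl_0 Q = irl_f Q \<otimes>\<^bsub>Q\<^esub> irl_f Q"
      \<comment> \<open>Identifying the bounds puts \<open>tt \<rightharpoonup> bb\<close> into
        \<open>G\<close>, and this element is \<open>bb\<close>.\<close>
      then have "M.bb \<in> G"
        by (simp add: quotient_derived quotient_simps(3) cls_eq_iff M.tt_imp_bb)
      then have "carrier A \<subseteq> G"
        using filter_up[OF _ M.bb_leq] by blast
      moreover have "G \<subseteq> carrier A" "G \<noteq> carrier A"
        using prime by (auto simp: prime_e_filter_def e_filter_def)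
      ultimately show False
        by blast
    qed
  next
    fix X Y assume "X \<in> carrier Q" "Y \<in> carrier Q" and le: "\<one>\<^bsub>Q\<^esub> \<preceq>\<^bsub>Q\<^esub> X \<nabla>\<^bsub>Q\<^esub> Y"
    then obtain x y where xy [simp]: "x \<in> carrier A" "y \<in> carrier A" and XY: "X = cls x" "Y = cls y"
      unfolding quotient_simps(1) by blast
    \<comment> \<open>Since \<open>\<one> \<rightharpoonup> z\<close> is \<open>z\<close>, a class
      lies above the identity exactly when its representative is in \<open>G\<close>.\<close>
    have "x \<nabla> y \<in> G"
      using le by (simp add: XY quotient_simps(2,5) quotient_leq_iff one_imp)
    then have "x \<in> G \<or> y \<in> G"
      using prime xy unfolding prime_e_filter_def by blast
    then show "\<one>\<^bsub>Q\<^esub> \<preceq>\<^bsub>Q\<^esub> X \<or> \<one>\<^bsub>Q\<^esub> \<preceq>\<^bsub>Q\<^esub> Y"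
      by (simp add: XY quotient_simps(2) quotient_leq_iff one_imp)
  qed
qed

text \<open>Composes the projection with the isomorphism. The kernel is recorded so that the family
  can be indexed by congruences.\<close>

lemma (in De_Morgan_monoid) prime_filter_skew_hom:
  assumes "in_M A" and prime: "prime_e_filter A G"
  shows "\<exists>F \<phi>. (\<exists>B :: 'a set rl. Dunn_monoid B \<and> skew_reflection B F) \<and> \<phi> \<in> irl_hom A F \<and>
    \<phi> ` carrier A = carrier F \<and>
    (\<forall>x\<in>carrier A. \<forall>y\<in>carrier A. \<phi> x = \<phi> y \<longleftrightarrow> (x, y) \<in> filter_cong A G)"
proof -
  interpret De_Morgan_filter A G
    using prime by unfold_locales (simp add: prime_e_filter_def)
  interpret Q: M_prime_algebra Q
    using assms by (rule M_prime_quotient)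
  interpret B: Dunn_monoid Q.core_rl
    by (rule Q.Dunn_core)
  obtain h where h: "h \<in> irl_hom Q Q.core_skew" "bij_betw h (carrier Q) (carrier Q.core_skew)"
    by (rule Q.ex_iso_skew_reflection)
  have "skew_reflection Q.core_rl Q.core_skew"
    unfolding skew_reflection_def
    using B.residuated_lattice_axioms B.square_increasing Q.skew_order_core by blast
  moreover have "cls \<in> irl_hom A Q"
    by (rule irl_homI) (simp_all add: quotient_simps del: Image_singleton_iff)
  then have "(\<lambda>x. h (cls x)) \<in> irl_hom A Q.core_skew"
    using h(1) by (rule irl_hom_compose)
  moreover have "(\<lambda>x. h (cls x)) ` carrier A = carrier Q.core_skew"
    using h(2) by (simp add: bij_betw_def quotient_simps(1) image_image)
  moreover have "h (cls x) = h (cls y) \<longleftrightarrow> (x, y) \<in> filter_cong A G"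
    if "x \<in> carrier A" "y \<in> carrier A" for x y
  proof -
    have "h (cls x) = h (cls y) \<longleftrightarrow> cls x = cls y"
      using that h(2) unfolding bij_betw_def by (intro inj_on_eq_iff) (auto simp: quotient_simps(1))
    then show ?thesis
      using that by (simp add: cls_eq_iff filter_cong_iff)
  qed
  ultimately show ?thesis
    using Q.Dunn_core by blast
qed

text \<open>The map with components \<open>\<phi> i\<close> is injective by \<open>sep\<close>, and
  its image projects onto each factor by \<open>surj\<close>.\<close>

lemma (in involutive_residuated_lattice) subdirect_product_embedding:
  assumes hom: "\<And>i. i \<in> I \<Longrightarrow> \<phi> i \<in> irl_hom A (F i)"
    and surj: "\<And>i. i \<in> I \<Longrightarrow> \<phi> i ` carrier A = carrier (F i)"
    and sep: "\<And>x y. \<lbrakk>x \<in> carrier A; y \<in> carrier A; \<And>i. i \<in> I \<Longrightarrow> \<phi> i x = \<phi> i y\<rbrakk> \<Longrightarrow> x = y"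
  shows "\<exists>C. subdirect_product I F C \<and> irl_iso A C \<noteq> {}"
proof -
  let ?h = "\<lambda>x. \<lambda>i\<in>I. \<phi> i x" and ?P = "direct_product I F"
  let ?U = "?h ` carrier A"
  let ?C = "?P\<lparr>carrier := ?U\<rparr>"
  note homs = irl_homD[OF hom]
  have ops: "?h (x \<otimes> y) = ?h x \<otimes>\<^bsub>?P\<^esub> ?h y" "?h (x \<triangle> y) = ?h x \<triangle>\<^bsub>?P\<^esub> ?h y"
    "?h (x \<nabla> y) = ?h x \<nabla>\<^bsub>?P\<^esub> ?h y" if "x \<in> carrier A" "y \<in> carrier A" for x y
    using that by (auto simp: direct_product_def homs)
  have neg: "?h (neg x) = neg\<^bsub>?P\<^esub> (?h x)" if "x \<in> carrier A" for x
    using that by (auto simp: direct_product_def homs)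
  have one: "?h \<one> = \<one>\<^bsub>?P\<^esub>"
    by (auto simp: direct_product_def homs)
  have "subuniverse ?U ?P"
    unfolding subuniverse_def
  proof (intro conjI ballI)
    show "?U \<subseteq> carrier ?P"
      by (auto simp: direct_product_def homs)
    show "\<one>\<^bsub>?P\<^esub> \<in> ?U"
      unfolding one[symmetric] by blast
    fix u assume "u \<in> ?U"
    then obtain x where x: "x \<in> carrier A" "u = ?h x" by blast
    then show "neg\<^bsub>?P\<^esub> u \<in> ?U"
      using neg[OF x(1)] by (metis imageI neg_closed)
    fix v assume "v \<in> ?U"
    then obtain y where y: "y \<in> carrier A" "v = ?h y" by blast
    show "u \<otimes>\<^bsub>?P\<^esub> v \<in> ?U" "u \<triangle>\<^bsub>?P\<^esub> v \<in> ?U" "u \<nabla>\<^bsub>?P\<^esub> v \<in> ?U"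
      unfolding x(2) y(2) ops[OF x(1) y(1), symmetric] using x(1) y(1) by auto
  qed
  moreover have "(\<lambda>x. x i) ` ?U = carrier (F i)" if "i \<in> I" for i
    using surj[OF that] that by (simp add: image_image)
  ultimately have "subdirect_product I F ?C"
    unfolding subdirect_product_def by blast
  moreover have "inj_on ?h (carrier A)"
  proof (rule inj_onI)
    fix x y assume xy: "x \<in> carrier A" "y \<in> carrier A" and eq: "?h x = ?h y"
    show "x = y"
    proof (rule sep[OF xy])
      show "\<phi> i x = \<phi> i y" if "i \<in> I" for i
        using fun_cong[OF eq, of i] that by simp
    qed
  qed
  then have "?h \<in> irl_iso A ?C"
    unfolding irl_iso_eq
    by (auto intro!: irl_homI simp: ops neg one bij_betw_def)
  ultimately show ?thesis
    by blast
qed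

text \<open>One factor for each congruence of a prime filter. A trivial algebra has no prime filter,
  so the family is then empty.\<close>

lemma (in M_algebra) subdirect_of_skew_reflections:
  "subdirect_of_skew_reflections TYPE(('a \<times> 'a) set) TYPE('a set) A"
proof -
  let ?I = "filter_cong A ` {G. prime_e_filter A G}"
  let ?P = "\<lambda>\<theta> F \<phi>. (\<exists>B :: 'a set rl. Dunn_monoid B \<and> skew_reflection B F) \<and> \<phi> \<in> irl_hom A F \<and>
    \<phi> ` carrier A = carrier F \<and>
    (\<forall>x\<in>carrier A. \<forall>y\<in>carrier A. \<phi> x = \<phi> y \<longleftrightarrow> (x, y) \<in> \<theta>)"
  have "\<forall>\<theta>\<in>?I. \<exists>F \<phi>. ?P \<theta> F \<phi>"
    using prime_filter_skew_hom[OF in_M] by blast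
  \<comment> \<open>Choice is applied twice, first to the factors and then to the
    homomorphisms.\<close>
  from bchoice[OF this] obtain F where "\<forall>\<theta>\<in>?I. \<exists>\<phi>. ?P \<theta> (F \<theta>) \<phi>" ..
  from bchoice[OF this] obtain \<phi> where P: "\<forall>\<theta>\<in>?I. ?P \<theta> (F \<theta>) (\<phi> \<theta>)" ..
  have F: "\<exists>B :: 'a set rl. Dunn_monoid B \<and> skew_reflection B (F \<theta>)" if "\<theta> \<in> ?I" for \<theta>
    using P that by blast
  have hom: "\<phi> \<theta> \<in> irl_hom A (F \<theta>)" if "\<theta> \<in> ?I" for \<theta>
    using P that by blast
  have surj: "\<phi> \<theta> ` carrier A = carrier (F \<theta>)" if "\<theta> \<in> ?I" for \<theta>
    using P that by blast
  have ker: "\<phi> \<theta> x = \<phi> \<theta> y \<longleftrightarrow> (x, y) \<in> \<theta>" if "\<theta> \<in> ?I" "x \<in> carrier A" "y \<in> carrier A" for \<theta> x y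
    using P that by blast
  have sep: "x \<preceq> y" if xy: "x \<in> carrier A" "y \<in> carrier A" and eq: "\<And>\<theta>. \<theta> \<in> ?I \<Longrightarrow> \<phi> \<theta> x = \<phi> \<theta> y"
    for x y
  proof (rule ccontr)
    \<comment> \<open>Then \<open>x \<rightharpoonup> y\<close> is not above \<open>e\<close>, so
      some prime filter omits it and its quotient distinguishes \<open>x\<close> from
      \<open>y\<close>.\<close>
    assume "\<not> x \<preceq> y"
    then have "\<not> \<one> \<preceq> x \<rightharpoonup> y"
      using xy by (simp add: leq_iff_one_leq_imp)
    with xy obtain G where G: "prime_e_filter A G" "x \<rightharpoonup> y \<notin> G"
      by (rule_tac prime_e_filter_separation[of "x \<rightharpoonup> y"]) auto
    then have "(x, y) \<in> filter_cong A G"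
      using eq ker[OF _ xy] by blast
    then show False
      using G(2) by (simp add: filter_cong_def)
  qed
  have "\<exists>C. subdirect_product ?I F C \<and> irl_iso A C \<noteq> {}"
  proof (rule subdirect_product_embedding[OF hom surj])
    fix x y assume "x \<in> carrier A" "y \<in> carrier A" "\<And>\<theta>. \<theta> \<in> ?I \<Longrightarrow> \<phi> \<theta> x = \<phi> \<theta> y"
    then show "x = y"
      using sep[of x y] sep[of y x] leq_antisym[of x y] by metis
  qed
  then show ?thesis
    unfolding subdirect_of_skew_reflections_def using F by blast
qed

section \<open>Skew reflections satisfy the axioms of M\<close>

lemma (in involutive_residuated_lattice) irl_hom_derived:
  assumes "h \<in> irl_hom A C"
  shows "h (irl_f A) = irl_f C" "h (irl_0 A) = irl_0 C"
    "\<lbrakk>x \<in> carrier A; y \<in> carrier A\<rbrakk> \<Longrightarrow> h (x \<rightharpoonup> y) = irl_imp C (h x) (h y)"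
  by (simp_all add: irl_f_def irl_0_def irl_imp_def irl_homD[OF assms])

locale skew_reflection_order = residuated_lattice +
  fixes r
  assumes order: "skew_order B r"
begin

abbreviation S where "S \<equiv> skew_algebra B r"

lemma S_simps [simp]:
  "carrier S = skew_carrier B" "s \<otimes>\<^bsub>S\<^esub> t = skew_mult B s t" "neg\<^bsub>S\<^esub> s = skew_neg s"
  "\<one>\<^bsub>S\<^esub> = Base \<one>"
  by (simp_all add: skew_algebra_def)

lemma S_f: "irl_f S = Refl \<one>" and S_0: "irl_0 S = Zero"
  by (simp_all add: irl_f_def irl_0_def)

lemma skew_antisym: "\<lbrakk>r s t; r t s; s \<in> skew_carrier B; t \<in> skew_carrier B\<rbrakk> \<Longrightarrow> s = t"
  and skew_refl: "s \<in> skew_carrier B \<Longrightarrow> r s s"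
proof -
  interpret L: lattice "skew_gorder B r"
    using order by (simp add: skew_order_def)
  show "\<lbrakk>r s t; r t s; s \<in> skew_carrier B; t \<in> skew_carrier B\<rbrakk> \<Longrightarrow> s = t"
    using L.le_antisym[of s t] by simp
  show "s \<in> skew_carrier B \<Longrightarrow> r s s"
    using L.le_refl[of s] by simp
qed

lemma r_bounds: "s \<in> skew_carrier B \<Longrightarrow> r Zero s \<and> r s One"
proof (erule skew_carrier_cases)
  have "r Zero (Base \<one>)" "r (Base \<one>) One"
    using order by (auto simp: skew_order_def)
  moreover interpret L: lattice "skew_gorder B r"
    using order by (simp add: skew_order_def)
  \<comment> \<open>The definition compares the bounds only with \<open>Base\<close> and
    \<open>Refl\<close> elements, so this goes through \<open>Base \<one>\<close>.\<close>
  have "r Zero One" if "r Zero (Base \<one>)" "r (Base \<one>) One"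
    using L.le_trans[of Zero "Base \<one>" One] that by simp
  ultimately show "s = Zero \<Longrightarrow> r Zero s \<and> r s One" "s = One \<Longrightarrow> r Zero s \<and> r s One"
    by (simp_all add: skew_refl)
qed (use order in \<open>auto simp: skew_order_def\<close>)

text \<open>Here \<open>f\<close> is a reflected element, so its square is
  \<open>One\<close>.\<close>

lemma leq_One: "s \<in> skew_carrier B \<Longrightarrow> s \<preceq>\<^bsub>S\<^esub> irl_f S \<otimes>\<^bsub>S\<^esub> irl_f S"
  using skew_lattice_ops[OF order, of s One] skew_refl[of s] r_bounds[of s]
  by (auto simp: leq_def S_f intro!: skew_antisym)

lemma skew_imp_closed:
  assumes "s \<in> skew_carrier B" "t \<in> skew_carrier B"
  shows "irl_imp S s t \<in> skew_carrier B"
  by (rule skew_carrier_cases[OF assms(1)]; rule skew_carrier_cases[OF assms(2)])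
    (simp_all add: irl_imp_def imp_closed)

text \<open>For every form of \<open>s\<close> one of the two implications differs from
  \<open>Zero\<close>, hence so does their join; the join times \<open>One\<close> is then
  \<open>One\<close>, whose negation is \<open>Zero\<close>.\<close>

lemma skew_M_equation:
  assumes s: "s \<in> skew_carrier B"
  shows "irl_imp S (irl_imp S (irl_f S) s \<nabla>\<^bsub>S\<^esub> irl_imp S s \<one>\<^bsub>S\<^esub>) (irl_0 S) = irl_0 S"
proof -
  let ?a = "irl_imp S (irl_f S) s" and ?b = "irl_imp S s \<one>\<^bsub>S\<^esub>"
  let ?j = "?a \<nabla>\<^bsub>S\<^esub> ?b"
  have ab: "?a \<in> skew_carrier B" "?b \<in> skew_carrier B"
    using s by (simp_all add: skew_imp_closed S_f)
  note ops = skew_lattice_ops[OF order ab]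
  have "?a \<noteq> Zero \<or> ?b \<noteq> Zero"
    using s by (rule skew_carrier_cases) (simp_all add: irl_imp_def S_f)
  moreover have "c = Zero" if "r c Zero" "c \<in> skew_carrier B" for c
    using that r_bounds by (intro skew_antisym) auto
  ultimately have "?j \<noteq> Zero"
    using ops(6,7) ab by metis
  then have "irl_imp S ?j Zero = Zero"
    using ops(5) by (cases ?j) (simp_all add: irl_imp_def)
  then show ?thesis
    by (simp add: S_0)
qed

end

text \<open>The bound and the equation are checked coordinatewise. The inequality
  \<open>\<one> \<preceq> ff\<close> is assumed, since \<open>skew_order\<close> leaves open whether
  \<open>Base \<one>\<close> lies below \<open>Refl \<one>\<close>.\<close>

lemma (in De_Morgan_monoid) in_M_if_subdirect:
  assumes e_le_f: "\<one> \<preceq> ff"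
    and sub: "subdirect_of_skew_reflections TYPE('i) TYPE('b) A"
  shows "in_M A"
proof -
  obtain I :: "'i set" and F :: "'i \<Rightarrow> 'b skew irl" and C
    where F: "\<forall>i\<in>I. \<exists>B. Dunn_monoid B \<and> skew_reflection B (F i)"
      and C: "subdirect_product I F C" and "irl_iso A C \<noteq> {}"
    using sub unfolding subdirect_of_skew_reflections_def by (elim exE conjE)
  then obtain h where h: "h \<in> irl_iso A C"
    by blast
  obtain U where U: "subuniverse U (direct_product I F)" "C = (direct_product I F)\<lparr>carrier := U\<rparr>"
    using C unfolding subdirect_product_def by (elim exE conjE)
  have hC: "h \<in> irl_hom A C" and bij: "bij_betw h (carrier A) U"
    using h U by (auto simp: irl_iso_eq)
  have hU: "h x \<in> (\<Pi>\<^sub>E i\<in>I. carrier (F i))" if "x \<in> carrier A" for x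
    using irl_homD(1)[OF hC that] U by (auto simp: subuniverse_def direct_product_def)
  have hom: "(\<lambda>x. h x i) \<in> irl_hom A (F i)" if "i \<in> I" for i
    using that hU by (intro irl_homI) (auto simp: irl_homD[OF hC] U(2) direct_product_def)
  have sep: "x = y"
    if xy: "x \<in> carrier A" "y \<in> carrier A" and eq: "\<And>i. i \<in> I \<Longrightarrow> h x i = h y i" for x y
  proof -
    have "h x = h y"
      using hU[OF xy(1)] hU[OF xy(2)] eq by (rule PiE_ext)
    then show ?thesis
      using bij xy by (auto simp: bij_betw_def dest: inj_onD)
  qed
  have skew: "\<exists>B r. skew_reflection_order B r \<and> F i = skew_algebra B r"
    if i: "i \<in> I" for i
  proof -
    obtain B where "skew_reflection B (F i)"
      using F i by blast
    then show ?thesis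
      unfolding skew_reflection_def skew_reflection_order_def skew_reflection_order_axioms_def
      by blast
  qed
  have bound: "x \<preceq> ff \<otimes> ff" if x: "x \<in> carrier A" for x
    unfolding leq_def
  proof (rule sep)
    fix i assume i: "i \<in> I"
    obtain B r where "skew_reflection_order B r" and Fi: "F i = skew_algebra B r"
      using skew[OF i] by blast
    then interpret skew_reflection_order B r
      by simp
    have "h x i \<in> skew_carrier B"
      using irl_homD(1)[OF hom[OF i] x] by (simp add: Fi)
    from leq_One[OF this] show "h (x \<triangle> (ff \<otimes> ff)) i = h x i"
      using x by (simp add: irl_homD[OF hom[OF i]] irl_hom_derived[OF hom[OF i]] Fi leq_def)
  qed (use x in auto)
  have eq: "((ff \<rightharpoonup> x) \<nabla> (x \<rightharpoonup> \<one>)) \<rightharpoonup> irl_0 A = irl_0 A" if x: "x \<in> carrier A" for x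
  proof (rule sep)
    fix i assume i: "i \<in> I"
    obtain B r where "skew_reflection_order B r" and Fi: "F i = skew_algebra B r"
      using skew[OF i] by blast
    then interpret skew_reflection_order B r
      by simp
    have "h x i \<in> skew_carrier B"
      using irl_homD(1)[OF hom[OF i] x] by (simp add: Fi)
    from skew_M_equation[OF this]
    show "h (((ff \<rightharpoonup> x) \<nabla> (x \<rightharpoonup> \<one>)) \<rightharpoonup> irl_0 A) i = h (irl_0 A) i"
      using x by (simp add: irl_homD[OF hom[OF i]] irl_hom_derived[OF hom[OF i]] Fi)
  qed (use x in auto)
  show ?thesis
    using De_Morgan_monoid_axioms e_le_f bound eq square_increasing
    by (simp add: in_M_def anti_idempotent_def)
qed

text \<open>The forward direction fixes types large enough for the representation: congruences as
  indices, classes as elements of the Dunn monoids. The second conjunct gives the converse for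
  arbitrary types.\<close>

theorem corollary5p8:
  fixes A :: "'a irl"
  assumes "De_Morgan_monoid A"
  shows "(in_M A \<longleftrightarrow>
            \<one>\<^bsub>A\<^esub> \<preceq>\<^bsub>A\<^esub> irl_f A \<and>
            subdirect_of_skew_reflections TYPE(('a \<times> 'a) set) TYPE('a set) A) \<and>
         (\<one>\<^bsub>A\<^esub> \<preceq>\<^bsub>A\<^esub> irl_f A \<and>
            subdirect_of_skew_reflections TYPE('i) TYPE('b) A \<longrightarrow> in_M A)"
proof -
  have "subdirect_of_skew_reflections TYPE(('a \<times> 'a) set) TYPE('a set) A" if "in_M A"
    using assms that
    by (intro M_algebra.subdirect_of_skew_reflections M_algebra.intro M_algebra_axioms.intro)
  moreover have "\<one>\<^bsub>A\<^esub> \<preceq>\<^bsub>A\<^esub> irl_f A" if "in_M A"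
    using that by (simp add: in_M_def)
  moreover note De_Morgan_monoid.in_M_if_subdirect[OF assms,
      where 'i = "('a \<times> 'a) set" and 'b = "'a set"]
    De_Morgan_monoid.in_M_if_subdirect[OF assms, where 'i = 'i and 'b = 'b]
  ultimately show ?thesis
    by blast
qed

end
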